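(* Suppose $\psi(M_1)\neq 0$, let $\xi\in\mathbb{C}$, and let $\bar w=\overline{1\otimes 1}\in L_{\psi,\xi}$. Then $v\in L_{\psi,\xi}$ is a Whittaker vector (that is, $xv=\psi(x)v$ for all $x\in\mathfrak{sv}^+$) if and only if $v=u\bar w$ for some $u\in\mathbb{C}1$, i.e. $v$ is a scalar multiple of $\bar w$.
   Context: The Schrödinger-Virasoro algebra $\mathfrak{sv}$ is the complex Lie algebra with basis $\{L_n,M_n,Y_{n+\frac12}\mid n\in\mathbb{Z}\}$ and brackets, for $m,n\in\mathbb{Z}$: $[L_m,L_n]=(n-m)L_{m+n}$, $[L_m,M_n]=nM_{m+n}$, $[L_m,Y_{n+\frac12}]=(n+\frac{1-m}{2})Y_{m+n+\frac12}$, $[Y_{m+\frac12},Y_{n+\frac12}]=(n-m)M_{m+n+1}$, $[M_m,M_n]=[M_m,Y_{n+\frac12}]=0$. The element $M_0$ is central. Put $\mathfrak{sv}^+=\mathrm{span}_{\mathbb{C}}\{L_n,M_n,Y_{m+\frac12}\mid n\geq 1,\ m\geq 0\}$. Let $\psi:\mathfrak{sv}^+\to\mathbb{C}$ be a Lie algebra homomorphism. Write $U(\cdot)$ for the universal enveloping algebra. Let $\mathbb{C}_\psi$ be the one-dimensional $\mathfrak{sv}^+$-module with $x\alpha=\psi(x)\alpha$ for $x\in\mathfrak{sv}^+$, $\alpha\in\mathbb{C}$, let $W_\psi=U(\mathfrak{sv})\otimes_{U(\mathfrak{sv}^+)}\mathbb{C}_\psi$, and for $\xi\in\mathbb{C}$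 let $L_{\psi,\xi}=W_\psi/(M_0-\xi)W_\psi$; $\overline{1\otimes1}$ denotes the image of $1\otimes 1\in W_\psi$ in $L_{\psi,\xi}$. *)

theory Defs
  imports Complex_Main "HOL-Library.Poly_Mapping" "HOL-Algebra.QuotRing"
    "HOL-Algebra.Generated_Groups" "HOL-Algebra.Free_Abelian_Groups"
begin

section \<open>Lie algebras given by a basis\<close>

text \<open>The complex vector space with basis \<open>'b\<close> is \<open>'b \<Rightarrow>\<^sub>0 complex\<close>, and the span of a set \<open>B\<close> of
  basis vectors consists of the elements supported on \<open>B\<close>. A bracket is a function on
  \<open>'b \<Rightarrow>\<^sub>0 complex\<close>, so that the same bracket serves for the Lie algebra and for the subalgebras
  spanned by part of the basis.\<close>

abbreviation bvec :: "'b \<Rightarrow> ('b \<Rightarrow>\<^sub>0 complex)"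
  where "bvec b \<equiv> Poly_Mapping.single b 1"

definition scale :: "complex \<Rightarrow> ('b \<Rightarrow>\<^sub>0 complex) \<Rightarrow> ('b \<Rightarrow>\<^sub>0 complex)"
  where "scale c x = Poly_Mapping.map ((*) c) x"

definition bspan :: "'b set \<Rightarrow> ('b \<Rightarrow>\<^sub>0 complex) set"
  where "bspan B = {x. Poly_Mapping.keys x \<subseteq> B}"

definition bilinear_ext ::
  "('b \<Rightarrow> 'b \<Rightarrow> ('b \<Rightarrow>\<^sub>0 complex)) \<Rightarrow> ('b \<Rightarrow>\<^sub>0 complex) \<Rightarrow> ('b \<Rightarrow>\<^sub>0 complex) \<Rightarrow> ('b \<Rightarrow>\<^sub>0 complex)"
  where "bilinear_ext f x y = (\<Sum>a\<in>Poly_Mapping.keys x. \<Sum>b\<in>Poly_Mapping.keys y.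
           scale (Poly_Mapping.lookup x a * Poly_Mapping.lookup y b) (f a b))"

lemma lookup_scale [simp]: "Poly_Mapping.lookup (scale c x) b = c * Poly_Mapping.lookup x b"
  by (simp add: scale_def Poly_Mapping.map.rep_eq when_def)

lemma scale_simps:
  "scale c (x + y) = scale c x + scale c y" "scale (c + d) x = scale c x + scale d x"
  "scale c (scale d x) = scale (c * d) x" "scale 0 x = 0" "scale c 0 = 0" "scale 1 x = x"
  "scale c (- x) = - scale c x" "- scale c x = scale (- c) x"
  by (auto intro!: poly_mapping_eqI simp: algebra_simps lookup_add)

lemma scale_sum: "scale c (sum f A) = (\<Sum>a\<in>A. scale c (f a))"
  by (induction A rule: infinite_finite_induct) (simp_all add: scale_simps)

lemma bilinear_ext_superset:
  assumes "finite A" "finite B" "Poly_Mapping.keys x \<subseteq> A" "Poly_Mapping.keys y \<subseteq> B"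
  shows "bilinear_ext f x y = (\<Sum>a\<in>A. \<Sum>b\<in>B.
           scale (Poly_Mapping.lookup x a * Poly_Mapping.lookup y b) (f a b))"
proof -
  have "bilinear_ext f x y = (\<Sum>a\<in>Poly_Mapping.keys x. \<Sum>b\<in>B.
           scale (Poly_Mapping.lookup x a * Poly_Mapping.lookup y b) (f a b))"
    unfolding bilinear_ext_def
    by (intro sum.cong refl sum.mono_neutral_left)
       (use assms in \<open>auto simp: in_keys_iff scale_simps\<close>)
  also have "\<dots> = (\<Sum>a\<in>A. \<Sum>b\<in>B.
           scale (Poly_Mapping.lookup x a * Poly_Mapping.lookup y b) (f a b))"
    by (intro sum.mono_neutral_left)
       (use assms in \<open>auto simp: in_keys_iff scale_simps\<close>)
  finally show ?thesis .
qed

lemma bilinear_ext_add_left: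
  "bilinear_ext f (x + x') y = bilinear_ext f x y + bilinear_ext f x' y"
proof -
  let ?A = "Poly_Mapping.keys x \<union> Poly_Mapping.keys x'" and ?B = "Poly_Mapping.keys y"
  have k: "Poly_Mapping.keys (x + x') \<subseteq> ?A" by (rule keys_add)
  show ?thesis
    by (subst (1 2 3) bilinear_ext_superset[where A = ?A and B = ?B])
       (use k in \<open>auto simp: lookup_add distrib_right scale_simps sum.distrib\<close>)
qed

lemma bilinear_ext_add_right:
  "bilinear_ext f x (y + y') = bilinear_ext f x y + bilinear_ext f x y'"
proof -
  let ?B = "Poly_Mapping.keys y \<union> Poly_Mapping.keys y'" and ?A = "Poly_Mapping.keys x"
  have k: "Poly_Mapping.keys (y + y') \<subseteq> ?B" by (rule keys_add)
  show ?thesis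
    by (subst (1 2 3) bilinear_ext_superset[where A = ?A and B = ?B])
       (use k in \<open>auto simp: lookup_add distrib_left scale_simps sum.distrib\<close>)
qed

lemma bilinear_ext_scale:
  "bilinear_ext f (scale c x) y = scale c (bilinear_ext f x y)"
  "bilinear_ext f x (scale c y) = scale c (bilinear_ext f x y)"
proof -
  have k: "Poly_Mapping.keys (scale c z) \<subseteq> Poly_Mapping.keys z" for z :: "'a \<Rightarrow>\<^sub>0 complex"
    by (auto simp: in_keys_iff)
  show "bilinear_ext f (scale c x) y = scale c (bilinear_ext f x y)"
    "bilinear_ext f x (scale c y) = scale c (bilinear_ext f x y)"
    by (subst (1 2) bilinear_ext_superset[where A = "Poly_Mapping.keys x" and B = "Poly_Mapping.keys y"];
       use k in \<open>auto simp: scale_sum scale_simps mult_ac\<close>)+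
qed

lemma bilinear_ext_0 [simp]: "bilinear_ext f 0 y = 0" "bilinear_ext f x 0 = 0"
  by (simp_all add: bilinear_ext_def)

lemma bilinear_ext_bvec: "bilinear_ext f (bvec a) (bvec b) = f a b"
  by (simp add: bilinear_ext_def scale_simps)

lemma single_scale: "Poly_Mapping.single b c = scale c (bvec b)"
  by (rule poly_mapping_eqI) (auto simp: lookup_single when_def)

lemma scale_bvec_induct:
  fixes P :: "('b \<Rightarrow>\<^sub>0 complex) \<Rightarrow> bool"
  assumes single: "\<And>b c. P (scale c (bvec b))" and add: "\<And>x y. P x \<Longrightarrow> P y \<Longrightarrow> P (x + y)"
  shows "P x"
proof (induction x rule: update_induct)
  case const
  show ?case using single[of 0] by (simp add: scale_simps)
next
  case (update f a b)
  then have "Poly_Mapping.update a b f = f + scale b (bvec a)"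
    by (intro poly_mapping_eqI)
       (auto simp: lookup_update lookup_add lookup_single when_def in_keys_iff)
  with update show ?case by (simp add: single add)
qed

lemma bilinear_ext_minus:
  "bilinear_ext f (- x) y = - bilinear_ext f x y" "bilinear_ext f x (- y) = - bilinear_ext f x y"
proof -
  have m: "- z = scale (- 1) z" for z :: "'b \<Rightarrow>\<^sub>0 complex"
    by (rule poly_mapping_eqI) simp
  show "bilinear_ext f (- x) y = - bilinear_ext f x y" "bilinear_ext f x (- y) = - bilinear_ext f x y"
    unfolding m bilinear_ext_scale by (rule refl)+
qed

lemma bspan_scale: "x \<in> bspan B \<Longrightarrow> scale c x \<in> bspan B"
  by (auto simp: bspan_def in_keys_iff)

lemma bspan_add: "x \<in> bspan B \<Longrightarrow> y \<in> bspan B \<Longrightarrow> x + y \<in> bspan B"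
  unfolding bspan_def using keys_add[of x y] by blast

lemma bspan_sum: "(\<And>a. a \<in> A \<Longrightarrow> g a \<in> bspan B) \<Longrightarrow> sum g A \<in> bspan B"
proof (induction A rule: infinite_finite_induct)
  case (insert a A)
  then show ?case by (simp add: bspan_add)
qed (simp_all add: bspan_def)

lemma bilinear_ext_bspan:
  assumes "\<And>a b. a \<in> B \<Longrightarrow> b \<in> B \<Longrightarrow> f a b \<in> bspan B" "x \<in> bspan B" "y \<in> bspan B"
  shows "bilinear_ext f x y \<in> bspan B"
  unfolding bilinear_ext_def
  by (intro bspan_sum bspan_scale assms(1)) (use assms(2,3) in \<open>auto simp: bspan_def\<close>)

text \<open>Lie algebra homomorphisms from the span of \<open>B\<close> to the (abelian) Lie algebra of complex
  numbers. Values outside the span are irrelevant.\<close>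

definition lie_hom_complex ::
  "'b set \<Rightarrow> (('b \<Rightarrow>\<^sub>0 complex) \<Rightarrow> ('b \<Rightarrow>\<^sub>0 complex) \<Rightarrow> ('b \<Rightarrow>\<^sub>0 complex)) \<Rightarrow>
    (('b \<Rightarrow>\<^sub>0 complex) \<Rightarrow> complex) \<Rightarrow> bool"
  where "lie_hom_complex B br \<psi> \<longleftrightarrow>
    (\<forall>x\<in>bspan B. \<forall>y\<in>bspan B. \<psi> (x + y) = \<psi> x + \<psi> y) \<and>
    (\<forall>c. \<forall>x\<in>bspan B. \<psi> (scale c x) = c * \<psi> x) \<and>
    (\<forall>x\<in>bspan B. \<forall>y\<in>bspan B. \<psi> (br x y) = \<psi> x * \<psi> y - \<psi> y * \<psi> x)"


section \<open>The universal enveloping algebra\<close>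

text \<open>Words in the basis form a monoid under concatenation. It is written additively because the
  product on \<^typ>\<open>'a \<Rightarrow>\<^sub>0 'b\<close> is the convolution over an additively written monoid; thus
  \<open>'b word \<Rightarrow>\<^sub>0 complex\<close> with \<open>*\<close> is the tensor algebra of \<open>'b \<Rightarrow>\<^sub>0 complex\<close>.\<close>

datatype 'b word = Word (letters: "'b list")

instantiation word :: (type) monoid_add
begin
definition zero_word :: "'b word" where "zero_word = Word []"
definition plus_word :: "'b word \<Rightarrow> 'b word \<Rightarrow> 'b word"
  where "plus_word u v = Word (letters u @ letters v)"
instance by standard (simp_all add: zero_word_def plus_word_def)
end

type_synonym 'b talg = "'b word \<Rightarrow>\<^sub>0 complex"

definition tensor_algebra :: "'b set \<Rightarrow> 'b talg ring"
  where "tensor_algebra B =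
    \<lparr>carrier = {p. \<forall>w\<in>Poly_Mapping.keys p. set (letters w) \<subseteq> B},
     mult = (*), one = 1, ring.zero = 0, add = (+)\<rparr>"

lemma ring_tensor_algebra: "ring (tensor_algebra B)"
proof -
  let ?T = "tensor_algebra B"
  define C where "C = carrier ?T"
  have C_iff: "p \<in> C \<longleftrightarrow> (\<forall>w\<in>Poly_Mapping.keys p. set (letters w) \<subseteq> B)" for p
    by (simp add: C_def tensor_algebra_def)
  have zero: "0 \<in> C" and one: "1 \<in> C"
    by (simp_all add: C_iff zero_word_def)
  have minus: "- p \<in> C" if "p \<in> C" for p
    using that by (simp add: C_iff)
  have add: "p + q \<in> C" if "p \<in> C" "q \<in> C" for p q
    using that keys_add[of p q] unfolding C_iff by blast
  have mult: "p * q \<in> C" if p: "p \<in> C" and q: "q \<in> C" for p q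
    unfolding C_iff
  proof
    fix w assume "w \<in> Poly_Mapping.keys (p * q)"
    then obtain u v where w: "w = u + v" and u: "u \<in> Poly_Mapping.keys p"
      and v: "v \<in> Poly_Mapping.keys q"
      by (rule subsetD[OF keys_mult, THEN CollectE]) (elim exE conjE)
    have "set (letters u) \<subseteq> B" "set (letters v) \<subseteq> B"
      using p q u v by (simp_all add: C_iff)
    then show "set (letters w) \<subseteq> B"
      by (simp add: w plus_word_def)
  qed
  have T: "?T = \<lparr>carrier = C, mult = (*), one = 1, ring.zero = 0, add = (+)\<rparr>"
    unfolding C_def by (simp add: tensor_algebra_def)
  have inverse: "\<exists>q\<in>C. p + q = 0" if "p \<in> C" for p
    using that by (intro bexI[of _ "- p"] minus) simp_all
  show ?thesis
    unfolding T
    by (intro ringI abelian_groupI monoidI)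
       (simp_all only: ring.simps monoid.simps partial_object.simps zero one add mult inverse
          add.assoc add.commute add.left_commute mult.assoc distrib_left distrib_right
          add_0_left add_0_right mult_1_left mult_1_right)
qed

definition tscalar :: "complex \<Rightarrow> 'b talg"
  where "tscalar c = Poly_Mapping.single 0 c"

definition tvec :: "('b \<Rightarrow>\<^sub>0 complex) \<Rightarrow> 'b talg"
  where "tvec x = (\<Sum>b\<in>Poly_Mapping.keys x. Poly_Mapping.single (Word [b]) (Poly_Mapping.lookup x b))"

definition uea_ideal ::
  "'b set \<Rightarrow> (('b \<Rightarrow>\<^sub>0 complex) \<Rightarrow> ('b \<Rightarrow>\<^sub>0 complex) \<Rightarrow> ('b \<Rightarrow>\<^sub>0 complex)) \<Rightarrow> 'b talg set"
  where "uea_ideal B br =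
    Idl\<^bsub>tensor_algebra B\<^esub> {tvec x * tvec y - tvec y * tvec x - tvec (br x y) | x y.
      x \<in> bspan B \<and> y \<in> bspan B}"

definition uea ::
  "'b set \<Rightarrow> (('b \<Rightarrow>\<^sub>0 complex) \<Rightarrow> ('b \<Rightarrow>\<^sub>0 complex) \<Rightarrow> ('b \<Rightarrow>\<^sub>0 complex)) \<Rightarrow> 'b talg set ring"
  where "uea B br = tensor_algebra B Quot uea_ideal B br"

definition uea_class ::
  "'b set \<Rightarrow> (('b \<Rightarrow>\<^sub>0 complex) \<Rightarrow> ('b \<Rightarrow>\<^sub>0 complex) \<Rightarrow> ('b \<Rightarrow>\<^sub>0 complex)) \<Rightarrow> 'b talg \<Rightarrow> 'b talg set"
  where "uea_class B br p = uea_ideal B br +>\<^bsub>tensor_algebra B\<^esub> p"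

text \<open>The homomorphism from the enveloping algebra of the subalgebra spanned by \<open>B\<close> to that of the
  one spanned by \<open>C\<close>, for \<open>B \<subseteq> C\<close>. A coset is mapped to the common class of its representatives.\<close>

definition uea_incl ::
  "'b set \<Rightarrow> (('b \<Rightarrow>\<^sub>0 complex) \<Rightarrow> ('b \<Rightarrow>\<^sub>0 complex) \<Rightarrow> ('b \<Rightarrow>\<^sub>0 complex)) \<Rightarrow> 'b talg set \<Rightarrow> 'b talg set"
  where "uea_incl C br a = the_elem (uea_class C br ` a)"


section \<open>Left modules, quotients and extension of scalars\<close>

text \<open>The locale \<open>module\<close> of the library is about commutative rings only. Here the underlying abelian
  group of a left module is a multiplicatively written group record (so \<open>mult\<close> is the addition of
  the module and \<open>one\<close> its zero), extended by the action of the ring.\<close>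

record ('r, 'm) lmodule = "'m monoid" +
  act :: "'r \<Rightarrow> 'm \<Rightarrow> 'm"

text \<open>The quotient by a submodule \<open>N\<close>; the coset of \<open>x\<close> is \<open>N #>\<^bsub>M\<^esub> x\<close>.\<close>

definition quot_module :: "('r, 'm) lmodule \<Rightarrow> 'm set \<Rightarrow> ('r, 'm set) lmodule"
  where "quot_module M N =
    \<lparr>carrier = carrier (M Mod N), mult = mult (M Mod N), one = one (M Mod N),
     act = (\<lambda>r X. the_elem ((\<lambda>x. N #>\<^bsub>M\<^esub> act M r x) ` X))\<rparr>"

text \<open>For a ring homomorphism \<open>f\<close> from \<open>S\<close> to \<open>R\<close> and a left \<open>S\<close>-module \<open>V\<close>, the left \<open>R\<close>-module
  \<open>R \<otimes>\<^sub>S V\<close> is the free abelian group on the pairs \<open>(r, v)\<close> modulo the subgroup generated by the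
  relations expressing biadditivity and \<open>S\<close>-balancedness.\<close>

definition free_pairs :: "('r, 'x) ring_scheme \<Rightarrow> ('s, 'v) lmodule \<Rightarrow> ('r, ('r \<times> 'v) \<Rightarrow>\<^sub>0 int) lmodule"
  where "free_pairs R V =
    (let F = free_Abelian_group (carrier R \<times> carrier V) in
    \<lparr>carrier = carrier F, mult = mult F, one = one F,
     act = (\<lambda>r. frag_extend (\<lambda>(r', v). frag_of (r \<otimes>\<^bsub>R\<^esub> r', v)))\<rparr>)"

definition tensor_relations ::
  "('s, 'y) ring_scheme \<Rightarrow> ('s \<Rightarrow> 'r) \<Rightarrow> ('r, 'x) ring_scheme \<Rightarrow> ('s, 'v) lmodule \<Rightarrow> (('r \<times> 'v) \<Rightarrow>\<^sub>0 int) set"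
  where "tensor_relations S f R V =
    {frag_of (r \<oplus>\<^bsub>R\<^esub> r', v) - frag_of (r, v) - frag_of (r', v) | r r' v.
       r \<in> carrier R \<and> r' \<in> carrier R \<and> v \<in> carrier V} \<union>
    {frag_of (r, v \<otimes>\<^bsub>V\<^esub> v') - frag_of (r, v) - frag_of (r, v') | r v v'.
       r \<in> carrier R \<and> v \<in> carrier V \<and> v' \<in> carrier V} \<union>
    {frag_of (r \<otimes>\<^bsub>R\<^esub> f s, v) - frag_of (r, act V s v) | r s v.
       r \<in> carrier R \<and> s \<in> carrier S \<and> v \<in> carrier V}"

definition tensor_subgroup ::
  "('s, 'y) ring_scheme \<Rightarrow> ('s \<Rightarrow> 'r) \<Rightarrow> ('r, 'x) ring_scheme \<Rightarrow> ('s, 'v) lmodule \<Rightarrow> (('r \<times> 'v) \<Rightarrow>\<^sub>0 int) set"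
  where "tensor_subgroup S f R V =
    generate (free_Abelian_group (carrier R \<times> carrier V)) (tensor_relations S f R V)"

definition tensor_module ::
  "('s, 'y) ring_scheme \<Rightarrow> ('s \<Rightarrow> 'r) \<Rightarrow> ('r, 'x) ring_scheme \<Rightarrow> ('s, 'v) lmodule \<Rightarrow>
    ('r, (('r \<times> 'v) \<Rightarrow>\<^sub>0 int) set) lmodule"
  where "tensor_module S f R V = quot_module (free_pairs R V) (tensor_subgroup S f R V)"

definition pure_tensor ::
  "('s, 'y) ring_scheme \<Rightarrow> ('s \<Rightarrow> 'r) \<Rightarrow> ('r, 'x) ring_scheme \<Rightarrow> ('s, 'v) lmodule \<Rightarrow>
    'r \<Rightarrow> 'v \<Rightarrow> (('r \<times> 'v) \<Rightarrow>\<^sub>0 int) set"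
  where "pure_tensor S f R V r v = tensor_subgroup S f R V #>\<^bsub>free_pairs R V\<^esub> frag_of (r, v)"


section \<open>The Schroedinger-Virasoro algebra\<close>

text \<open>\<open>Y n\<close> is the basis vector with index \<open>n + 1/2\<close>.\<close>

datatype sv_basis = L int | M int | Y int

type_synonym sv = "sv_basis \<Rightarrow>\<^sub>0 complex"

fun sv_basis_bracket :: "sv_basis \<Rightarrow> sv_basis \<Rightarrow> sv" where
  "sv_basis_bracket (L m) (L n) = scale (of_int (n - m)) (bvec (L (m + n)))"
| "sv_basis_bracket (L m) (M n) = scale (of_int n) (bvec (M (m + n)))"
| "sv_basis_bracket (L m) (Y n) = scale (of_int n + (1 - of_int m) / 2) (bvec (Y (m + n)))"
| "sv_basis_bracket (M n) (L m) = - scale (of_int n) (bvec (M (m + n)))"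
| "sv_basis_bracket (Y n) (L m) = - scale (of_int n + (1 - of_int m) / 2) (bvec (Y (m + n)))"
| "sv_basis_bracket (Y m) (Y n) = scale (of_int (n - m)) (bvec (M (m + n + 1)))"
| "sv_basis_bracket (M m) (M n) = 0"
| "sv_basis_bracket (M m) (Y n) = 0"
| "sv_basis_bracket (Y n) (M m) = 0"

definition sv_bracket :: "sv \<Rightarrow> sv \<Rightarrow> sv"
  where "sv_bracket = bilinear_ext sv_basis_bracket"

definition sv_plus_basis :: "sv_basis set"
  where "sv_plus_basis = {L n | n. 1 \<le> n} \<union> {M n | n. 1 \<le> n} \<union> {Y m | m. 0 \<le> m}"

definition sv_plus :: "sv set"
  where "sv_plus = bspan sv_plus_basis"

lemmas sv_bracket_simps = sv_bracket_def bilinear_ext_scale bilinear_ext_bvec bilinear_ext_add_left bilinear_ext_add_right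

lemma sv_bracket_antisym: "sv_bracket x y = - sv_bracket y x"
proof (induction x rule: scale_bvec_induct)
  case (1 b c)
  show ?case
  proof (induction y rule: scale_bvec_induct)
    case (1 b' c')
    show ?case
      by (cases b; cases b'; rule poly_mapping_eqI)
         (simp_all add: sv_bracket_simps lookup_single when_def algebra_simps)
  next
    case (2 y y')
    then show ?case by (simp add: sv_bracket_def bilinear_ext_add_left bilinear_ext_add_right)
  qed
next
  case (2 x x')
  then show ?case by (simp add: sv_bracket_def bilinear_ext_add_left bilinear_ext_add_right)
qed

lemma sv_bracket_jacobi:
  "sv_bracket x (sv_bracket y z) + sv_bracket y (sv_bracket z x) + sv_bracket z (sv_bracket x y) = 0"
  (is "?J x y z = 0")
proof -
  have basis: "?J (bvec b1) (bvec b2) (bvec b3) = 0" for b1 b2 b3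
  proof -
    have eq: "scale c v = 0" if "c = 0" for c and v :: sv
      using that by (simp add: scale_simps)
    have cong: "scale c v = scale d v" if "c = d" for c d and v :: sv
      using that by simp
    show ?thesis
      by (cases b1; cases b2; cases b3;
          simp add: sv_bracket_simps bilinear_ext_minus scale_simps(3,4,5,7) ac_simps;
          (simp only: scale_simps(8) diff_conv_add_uminus flip: scale_simps(2))?;
          (rule eq cong)?; (simp add: field_simps)?)
  qed
  have single: "?J (scale c1 (bvec b1)) (scale c2 (bvec b2)) (scale c3 (bvec b3)) = 0"
    for c1 c2 c3 b1 b2 b3
  proof -
    have "?J (scale c1 (bvec b1)) (scale c2 (bvec b2)) (scale c3 (bvec b3)) =
        scale (c1 * c2 * c3) (?J (bvec b1) (bvec b2) (bvec b3))"
      by (simp add: sv_bracket_def bilinear_ext_scale scale_simps(1,3) ac_simps)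
    then show ?thesis by (simp add: basis scale_simps)
  qed
  have add: "?J (x + x') y z = ?J x y z + ?J x' y z" "?J x (y + y') z = ?J x y z + ?J x y' z"
    "?J x y (z + z') = ?J x y z + ?J x y z'" for x x' y y' z z'
    by (simp_all add: sv_bracket_def bilinear_ext_add_left bilinear_ext_add_right)
  show ?thesis
  proof (induction x rule: scale_bvec_induct)
    case (1 b1 c1)
    show ?case
    proof (induction y rule: scale_bvec_induct)
      case (1 b2 c2)
      show ?case
      proof (induction z rule: scale_bvec_induct)
        case (1 b3 c3)
        show ?case by (rule single)
      next
        case (2 z z')
        then show ?case by (simp only: add add_0_left)
      qed
    next
      case (2 y y')
      then show ?case by (simp only: add add_0_left)
    qed
  next
    case (2 x x')
    then show ?case by (simp only: add add_0_left)
  qed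
qed

lemma sv_plus_bracket_closed: "x \<in> sv_plus \<Longrightarrow> y \<in> sv_plus \<Longrightarrow> sv_bracket x y \<in> sv_plus"
  unfolding sv_plus_def sv_bracket_def
proof (rule bilinear_ext_bspan)
  have b: "scale c (bvec g) \<in> bspan sv_plus_basis" if "g \<in> sv_plus_basis" for c g
    using that by (intro bspan_scale) (simp add: bspan_def)
  have z: "0 \<in> bspan sv_plus_basis"
    by (simp add: bspan_def)
  fix g h assume "g \<in> sv_plus_basis" "h \<in> sv_plus_basis"
  then show "sv_basis_bracket g h \<in> bspan sv_plus_basis"
    by (cases g; cases h; simp add: z scale_simps(8); intro b; simp add: sv_plus_basis_def)
qed

abbreviation sv_plus_character :: "(sv \<Rightarrow> complex) \<Rightarrow> bool"
  where "sv_plus_character \<equiv> lie_hom_complex sv_plus_basis sv_bracket"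

abbreviation U_sv :: "sv_basis talg set ring"
  where "U_sv \<equiv> uea UNIV sv_bracket"

abbreviation U_sv_plus :: "sv_basis talg set ring"
  where "U_sv_plus \<equiv> uea sv_plus_basis sv_bracket"

definition U_vec :: "sv \<Rightarrow> sv_basis talg set"
  where "U_vec x = uea_class UNIV sv_bracket (tvec x)"

definition U_scalar :: "complex \<Rightarrow> sv_basis talg set"
  where "U_scalar c = uea_class UNIV sv_bracket (tscalar c)"


section \<open>The Whittaker modules\<close>

text \<open>The module \<open>\<complex>\<^sub>\<psi>\<close>: a word acts by letting its letters \<open>x\<close> act as \<open>\<alpha> \<mapsto> \<psi> x * \<alpha>\<close> one after
  another, starting from the right; a coset acts as any of its representatives.\<close>

definition C_psi :: "(sv \<Rightarrow> complex) \<Rightarrow> (sv_basis talg set, complex) lmodule"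
  where "C_psi \<psi> =
    \<lparr>carrier = UNIV, mult = (+), one = 0,
     act = (\<lambda>u \<alpha>. the_elem ((\<lambda>p. \<Sum>w\<in>Poly_Mapping.keys p. Poly_Mapping.lookup p w *
               foldr (\<lambda>b \<beta>. \<psi> (bvec b) * \<beta>) (letters w) \<alpha>) ` u))\<rparr>"

definition W_psi ::
  "(sv \<Rightarrow> complex) \<Rightarrow> (sv_basis talg set, (sv_basis talg set \<times> complex \<Rightarrow>\<^sub>0 int) set) lmodule"
  where "W_psi \<psi> = tensor_module U_sv_plus (uea_incl UNIV sv_bracket) U_sv (C_psi \<psi>)"

definition w_psi :: "(sv \<Rightarrow> complex) \<Rightarrow> (sv_basis talg set \<times> complex \<Rightarrow>\<^sub>0 int) set"
  where "w_psi \<psi> =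
    pure_tensor U_sv_plus (uea_incl UNIV sv_bracket) U_sv (C_psi \<psi>) \<one>\<^bsub>U_sv\<^esub> 1"

text \<open>The subspace \<open>(M\<^sub>0 - \<xi>) W\<^sub>\<psi>\<close>; it is a submodule since \<open>M\<^sub>0\<close> is central.\<close>

definition central_submodule ::
  "(sv \<Rightarrow> complex) \<Rightarrow> complex \<Rightarrow> (sv_basis talg set \<times> complex \<Rightarrow>\<^sub>0 int) set set"
  where "central_submodule \<psi> \<xi> =
    act (W_psi \<psi>) (U_vec (bvec (M 0)) \<ominus>\<^bsub>U_sv\<^esub> U_scalar \<xi>) ` carrier (W_psi \<psi>)"

definition L_psi_xi ::
  "(sv \<Rightarrow> complex) \<Rightarrow> complex \<Rightarrow>
    (sv_basis talg set, (sv_basis talg set \<times> complex \<Rightarrow>\<^sub>0 int) set set) lmodule"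
  where "L_psi_xi \<psi> \<xi> = quot_module (W_psi \<psi>) (central_submodule \<psi> \<xi>)"

definition w_bar :: "(sv \<Rightarrow> complex) \<Rightarrow> complex \<Rightarrow> (sv_basis talg set \<times> complex \<Rightarrow>\<^sub>0 int) set set"
  where "w_bar \<psi> \<xi> = central_submodule \<psi> \<xi> #>\<^bsub>W_psi \<psi>\<^esub> w_psi \<psi>"

text \<open>The zero vector counts as a Whittaker vector.\<close>

definition whittaker_vector :: "(sv \<Rightarrow> complex) \<Rightarrow> (sv_basis talg set, 'm) lmodule \<Rightarrow> 'm \<Rightarrow> bool"
  where "whittaker_vector \<psi> V v \<longleftrightarrow>
    v \<in> carrier V \<and> (\<forall>x\<in>sv_plus. act V (U_vec x) v = act V (U_scalar (\<psi> x)) v)"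

end

theory Submission
  imports Defs
begin

text \<open>
  Write \<open>w\<close> for the generator of the module and \<open>Y n\<close> for the basis vector with index \<open>n + 1/2\<close>. The
  module is spanned by the vectors \<open>y\<^sub>1 \<cdots> y\<^sub>k w\<close> in which each \<open>y\<^sub>i\<close> is one of \<open>L n\<close> (\<open>n \<le> 0\<close>), \<open>M n\<close>
  and \<open>Y n\<close> (\<open>n \<le> - 1\<close>). Each of these \<open>y\<close> has a partner \<open>y*\<close> in \<open>sv_plus\<close> such that \<open>[y*, y]\<close> is a
  nonzero multiple of \<open>M 1\<close>: the pairs are \<open>L n\<close> with \<open>M (1 - n)\<close>, \<open>M n\<close> with \<open>L (1 - n)\<close>, and \<open>Y n\<close>
  with \<open>Y (- n)\<close>. Since \<open>\<psi> (M 1) \<noteq> 0\<close>, the deviation \<open>y* - \<psi> y*\<close> acts to leading order as a nonzero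
  multiple of the partial derivative \<open>d/dy\<close>, as if the \<open>y\<close> and their partners generated a Weyl
  algebra.

  To make ``leading order'' precise, basis vectors receive weights: \<open>3 - n\<close> for \<open>L n\<close>, \<open>- n\<close> for \<open>M n\<close>
  and \<open>1 - n\<close> for \<open>Y n\<close>. The weight of a bracket is the sum of the two weights minus 3, the weights
  of \<open>y\<close> and \<open>y*\<close> add up to 2, and every \<open>y\<close> has weight at least 1. Let \<open>F\<^sub>d\<close> be the span of the words
  of total weight at most \<open>d\<close>, applied to \<open>w\<close>. Then \<open>x - \<psi> x\<close> maps \<open>F\<^sub>d\<close> into \<open>F\<^sub>e\<close> for
  \<open>e = d + weight x - 2\<close> (\<open>deviation_deg_le\<close>), and the weighted Euler operator
  \<open>E = (\<Sum>y. weight y / c\<^sub>y * y * (y* - \<psi> y*))\<close>, where \<open>\<psi> [y*, y] = c\<^sub>y\<close>, acts on \<open>F\<^sub>d\<close> modulo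
  \<open>F\<^sub>d\<^sub>-\<^sub>1\<close> as multiplication by \<open>d\<close> (\<open>euler_deg_le\<close>). A Whittaker vector \<open>v\<close> in \<open>F\<^sub>d\<close> with \<open>d \<ge> 1\<close>
  satisfies \<open>E v = 0\<close>, so \<open>d v\<close> and therefore \<open>v\<close> lie in \<open>F\<^sub>d\<^sub>-\<^sub>1\<close>. The descent ends in \<open>F\<^sub>0\<close>, which
  consists of the scalar multiples of \<open>w\<close> (\<open>whittaker_scalar\<close>).

  The argument uses that the words span the module, together with relations that hold in it. It
  therefore takes place in the tensor algebra: a vector is represented by any \<open>p\<close> with \<open>v = p w\<close>,
  and equality of vectors is congruence modulo the left ideal that annihilates \<open>w\<close>. The theory of
  quotients and tensor products serves to show that \<open>w\<close> generates the module (\<open>Q_cyclic\<close>) and that its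
  annihilator contains the commutation relations, the elements \<open>x - \<psi> x\<close> for \<open>x\<close> in \<open>sv_plus\<close>, and
  all multiples of \<open>M 0 - \<xi>\<close> (\<open>whittaker_ideal_annihilator\<close>). Conversely, a scalar multiple of \<open>w\<close> is
  a Whittaker vector since \<open>w\<close> is one and scalars are central.
\<close>

section \<open>The tensor algebra\<close>

abbreviation letter :: "'b \<Rightarrow> 'b talg"
  where "letter b \<equiv> Poly_Mapping.single (Word [b]) 1"

lemma tscalar_simps:
  "tscalar 0 = 0" "tscalar 1 = 1"
  "tscalar (c + d) = tscalar c + tscalar d" "tscalar (c - d) = tscalar c - tscalar d"
  "tscalar (- c) = - tscalar c" "tscalar (c * d) = tscalar c * tscalar d"
  by (simp_all add: tscalar_def single_add single_diff single_uminus mult_single)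

lemma tscalar_commute: "tscalar c * p = p * tscalar c"
proof (induction p rule: scale_bvec_induct)
  case (1 w d)
  show ?case by (simp add: tscalar_def mult_single mult.commute flip: single_scale)
next
  case (2 p q)
  then show ?case by (simp add: distrib_left distrib_right)
qed

lemma tscalar_left_commute: "p * (tscalar c * q) = tscalar c * (p * q)"
  by (metis mult.assoc tscalar_commute)

lemma tvec_superset:
  assumes "finite A" "Poly_Mapping.keys x \<subseteq> A"
  shows "tvec x = (\<Sum>b\<in>A. Poly_Mapping.single (Word [b]) (Poly_Mapping.lookup x b))"
  unfolding tvec_def
  by (rule sum.mono_neutral_left) (use assms in \<open>auto simp: in_keys_iff\<close>)

lemma tvec_add: "tvec (x + y) = tvec x + tvec y"
  using keys_add[of x y]
  by (simp add: tvec_superset[where A = "Poly_Mapping.keys x \<union> Poly_Mapping.keys y"]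
      lookup_add single_add sum.distrib)

lemma tvec_scale: "tvec (scale c x) = tscalar c * tvec x"
proof -
  have "Poly_Mapping.keys (scale c x) \<subseteq> Poly_Mapping.keys x"
    by (auto simp: in_keys_iff)
  then show ?thesis
    by (simp add: tvec_superset[where A = "Poly_Mapping.keys x"] sum_distrib_left tscalar_def
        mult_single)
qed

lemma tvec_bvec: "tvec (bvec b) = letter b"
  by (simp add: tvec_def)

section \<open>Enveloping algebras\<close>

lemma tensor_algebra_simps:
  "p \<in> carrier (tensor_algebra B) \<longleftrightarrow> (\<forall>w\<in>Poly_Mapping.keys p. set (letters w) \<subseteq> B)"
  "p \<otimes>\<^bsub>tensor_algebra B\<^esub> q = p * q" "p \<oplus>\<^bsub>tensor_algebra B\<^esub> q = p + q"
  "\<one>\<^bsub>tensor_algebra B\<^esub> = 1" "\<zero>\<^bsub>tensor_algebra B\<^esub> = 0"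
  by (simp_all add: tensor_algebra_def)

lemma tensor_algebra_uminus:
  assumes "p \<in> carrier (tensor_algebra B)"
  shows "\<ominus>\<^bsub>tensor_algebra B\<^esub> p = - p"
proof -
  interpret ring "tensor_algebra B" by (rule ring_tensor_algebra)
  have "- p \<in> carrier (tensor_algebra B)"
    using assms by (simp add: tensor_algebra_simps)
  then show ?thesis
    using assms by (intro minus_equality) (simp_all add: tensor_algebra_simps(3,5))
qed

lemma tensor_algebra_zero_closed: "0 \<in> carrier (tensor_algebra B)"
  by (simp add: tensor_algebra_simps)

lemma tensor_algebra_uminus_closed:
  "p \<in> carrier (tensor_algebra B) \<Longrightarrow> - p \<in> carrier (tensor_algebra B)"
  by (simp add: tensor_algebra_simps)

lemma tensor_algebra_add_closed:
  assumes "p \<in> carrier (tensor_algebra B)" "q \<in> carrier (tensor_algebra B)"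
  shows "p + q \<in> carrier (tensor_algebra B)"
  using ring.ring_simprules(1)[OF ring_tensor_algebra assms] by (simp only: tensor_algebra_simps(3))

lemma tensor_algebra_diff_closed:
  "p \<in> carrier (tensor_algebra B) \<Longrightarrow> q \<in> carrier (tensor_algebra B) \<Longrightarrow>
    p - q \<in> carrier (tensor_algebra B)"
  using tensor_algebra_add_closed[of p B "- q"] by (simp add: tensor_algebra_uminus_closed)

lemma tensor_algebra_mult_closed:
  assumes "p \<in> carrier (tensor_algebra B)" "q \<in> carrier (tensor_algebra B)"
  shows "p * q \<in> carrier (tensor_algebra B)"
  using ring.ring_simprules(5)[OF ring_tensor_algebra assms] by (simp only: tensor_algebra_simps(2))

lemma tvec_closed: "x \<in> bspan B \<Longrightarrow> tvec x \<in> carrier (tensor_algebra B)"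
proof -
  assume x: "x \<in> bspan B"
  have "set (letters w) \<subseteq> B" if "w \<in> Poly_Mapping.keys (tvec x)" for w
  proof -
    have "w \<in> (\<Union>b\<in>Poly_Mapping.keys x.
        Poly_Mapping.keys (Poly_Mapping.single (Word [b]) (Poly_Mapping.lookup x b)))"
      using that keys_sum unfolding tvec_def by (rule subsetD[rotated])
    then show ?thesis
      using x by (auto simp: bspan_def split: if_split_asm)
  qed
  then show ?thesis by (simp add: tensor_algebra_simps)
qed

lemma tscalar_closed: "tscalar c \<in> carrier (tensor_algebra B)"
  by (auto simp: tensor_algebra_simps tscalar_def zero_word_def)

lemma tensor_idealI:
  assumes "I \<subseteq> carrier (tensor_algebra B)" "0 \<in> I"
    and "\<And>p q. p \<in> I \<Longrightarrow> q \<in> I \<Longrightarrow> p + q \<in> I" "\<And>p. p \<in> I \<Longrightarrow> - p \<in> I"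
    and "\<And>p q. p \<in> I \<Longrightarrow> q \<in> carrier (tensor_algebra B) \<Longrightarrow> q * p \<in> I"
    and "\<And>p q. p \<in> I \<Longrightarrow> q \<in> carrier (tensor_algebra B) \<Longrightarrow> p * q \<in> I"
  shows "ideal I (tensor_algebra B)"
proof (rule idealI[OF ring_tensor_algebra])
  interpret ring "tensor_algebra B" by (rule ring_tensor_algebra)
  show "subgroup I (add_monoid (tensor_algebra B))"
  proof (rule add.subgroupI)
    fix p assume p: "p \<in> I"
    then have "p \<in> carrier (tensor_algebra B)" using assms(1) by blast
    then show "\<ominus>\<^bsub>tensor_algebra B\<^esub> p \<in> I"
      using p assms(4) by (simp add: tensor_algebra_uminus)
  qed (use assms in \<open>auto simp: tensor_algebra_simps(3)\<close>)
qed (use assms in \<open>auto simp: tensor_algebra_simps(2)\<close>)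

text \<open>Instances are the whole algebra and the subalgebra spanned by part of its basis.\<close>

locale closed_bracket =
  fixes B :: "'b set" and br :: "('b \<Rightarrow>\<^sub>0 complex) \<Rightarrow> ('b \<Rightarrow>\<^sub>0 complex) \<Rightarrow> ('b \<Rightarrow>\<^sub>0 complex)"
  assumes closed: "x \<in> bspan B \<Longrightarrow> y \<in> bspan B \<Longrightarrow> br x y \<in> bspan B"
begin

abbreviation "relator x y \<equiv> tvec x * tvec y - tvec y * tvec x - tvec (br x y)"

lemma relator_closed: "x \<in> bspan B \<Longrightarrow> y \<in> bspan B \<Longrightarrow> relator x y \<in> carrier (tensor_algebra B)"
  by (intro tensor_algebra_diff_closed tensor_algebra_mult_closed tvec_closed closed)

lemma ideal_uea_ideal: "ideal (uea_ideal B br) (tensor_algebra B)"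
  unfolding uea_ideal_def
  by (rule ring.genideal_ideal[OF ring_tensor_algebra]) (use relator_closed in auto)

lemma ring_uea: "ring (uea B br)"
  unfolding uea_def by (rule ideal.quotient_is_ring[OF ideal_uea_ideal])

lemma uea_ideal_closed: "i \<in> uea_ideal B br \<Longrightarrow> i \<in> carrier (tensor_algebra B)"
proof -
  interpret I: ideal "uea_ideal B br" "tensor_algebra B" by (rule ideal_uea_ideal)
  show "i \<in> uea_ideal B br \<Longrightarrow> i \<in> carrier (tensor_algebra B)" by (rule I.a_Hcarr)
qed

lemma uea_ideal_zero: "0 \<in> uea_ideal B br"
  using additive_subgroup.zero_closed[OF ideal.axioms(1)[OF ideal_uea_ideal]]
  by (simp add: tensor_algebra_simps(5))

lemma uea_ideal_add: "i \<in> uea_ideal B br \<Longrightarrow> j \<in> uea_ideal B br \<Longrightarrow> i + j \<in> uea_ideal B br"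
  using additive_subgroup.a_closed[OF ideal.axioms(1)[OF ideal_uea_ideal]]
  by (simp add: tensor_algebra_simps(3))

lemma uea_ideal_mult:
  assumes "i \<in> uea_ideal B br" "p \<in> carrier (tensor_algebra B)"
  shows "p * i \<in> uea_ideal B br" "i * p \<in> uea_ideal B br"
proof -
  interpret I: ideal "uea_ideal B br" "tensor_algebra B" by (rule ideal_uea_ideal)
  show "p * i \<in> uea_ideal B br" "i * p \<in> uea_ideal B br"
    using I.I_l_closed[OF assms] I.I_r_closed[OF assms] by (simp_all only: tensor_algebra_simps(2))
qed

lemma uea_ideal_uminus: "i \<in> uea_ideal B br \<Longrightarrow> - i \<in> uea_ideal B br"
  using uea_ideal_mult(1)[OF _ tscalar_closed[of "- 1"]] by (simp add: tscalar_simps)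

lemma relator_in_ideal: "x \<in> bspan B \<Longrightarrow> y \<in> bspan B \<Longrightarrow> relator x y \<in> uea_ideal B br"
  unfolding uea_ideal_def
  by (rule subsetD[OF ring.genideal_self[OF ring_tensor_algebra]]) (use relator_closed in auto)

lemma uea_ideal_least:
  assumes "I \<subseteq> carrier (tensor_algebra B)" "0 \<in> I"
    and "\<And>p q. p \<in> I \<Longrightarrow> q \<in> I \<Longrightarrow> p + q \<in> I" "\<And>p. p \<in> I \<Longrightarrow> - p \<in> I"
    and "\<And>p q. p \<in> I \<Longrightarrow> q \<in> carrier (tensor_algebra B) \<Longrightarrow> q * p \<in> I"
    and "\<And>p q. p \<in> I \<Longrightarrow> q \<in> carrier (tensor_algebra B) \<Longrightarrow> p * q \<in> I"
    and "\<And>x y. x \<in> bspan B \<Longrightarrow> y \<in> bspan B \<Longrightarrow> relator x y \<in> I"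
  shows "uea_ideal B br \<subseteq> I"
proof -
  have "ideal I (tensor_algebra B)"
    by (rule tensor_idealI) (fact assms)+
  then show ?thesis
    unfolding uea_ideal_def
    by (rule ring.genideal_minimal[OF ring_tensor_algebra]) (use assms(7) in auto)
qed

lemma class_hom: "ring_hom_ring (tensor_algebra B) (uea B br) (uea_class B br)"
  using ideal.rcos_ring_hom_ring[OF ideal_uea_ideal] by (simp add: uea_def uea_class_def[abs_def])

lemma class_closed: "p \<in> carrier (tensor_algebra B) \<Longrightarrow> uea_class B br p \<in> carrier (uea B br)"
  using ring_hom_ring.homh[OF class_hom] by (rule ring_hom_closed)

lemma class_surj: "a \<in> carrier (uea B br) \<Longrightarrow> \<exists>p\<in>carrier (tensor_algebra B). a = uea_class B br p"
  by (auto simp: uea_def uea_class_def FactRing_def A_RCOSETS_def' a_r_coset_def')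

lemma class_zero: "i \<in> uea_ideal B br \<Longrightarrow> uea_class B br i = \<zero>\<^bsub>uea B br\<^esub>"
proof -
  interpret I: ideal "uea_ideal B br" "tensor_algebra B" by (rule ideal_uea_ideal)
  show "i \<in> uea_ideal B br \<Longrightarrow> ?thesis"
    by (simp add: uea_class_def uea_def FactRing_def I.a_rcos_const)
qed

text \<open>This justifies every operation that the definitions describe by picking representatives: such
  an operation is computed by any representative as soon as it ignores the ideal.\<close>

lemma the_elem_class:
  assumes p: "p \<in> carrier (tensor_algebra B)"
    and h: "\<And>i. i \<in> uea_ideal B br \<Longrightarrow> h (i + p) = h p"
  shows "the_elem (h ` uea_class B br p) = h p"
proof (rule the_elem_image_unique)
  show "uea_class B br p \<noteq> {}"
    using uea_ideal_zero unfolding uea_class_def a_r_coset_def' by blast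
  fix q assume "q \<in> uea_class B br p"
  then show "h q = h p"
    by (auto simp: uea_class_def a_r_coset_def' tensor_algebra_simps(3) h)
qed

lemma class_cong:
  assumes "i \<in> uea_ideal B br" "p \<in> carrier (tensor_algebra B)"
  shows "uea_class B br (i + p) = uea_class B br p"
proof -
  interpret h: ring_hom_ring "tensor_algebra B" "uea B br" "uea_class B br" by (rule class_hom)
  from h.hom_add[OF uea_ideal_closed[OF assms(1)] assms(2)] show ?thesis
    using assms by (simp add: tensor_algebra_simps(3) class_zero)
qed

end

text \<open>The ideal of the larger algebra, cut down to words over \<open>B\<close>, is an ideal that contains the
  relators of the smaller algebra. So it contains the ideal of the smaller algebra, and the class in
  the larger algebra depends on the class in the smaller one only.\<close>

lemma uea_incl_class:
  assumes "closed_bracket B br" "closed_bracket C br" "B \<subseteq> C" "p \<in> carrier (tensor_algebra B)"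
  shows "uea_incl C br (uea_class B br p) = uea_class C br p"
proof -
  interpret B: closed_bracket B br by fact
  interpret C: closed_bracket C br by fact
  have sub: "carrier (tensor_algebra B) \<subseteq> carrier (tensor_algebra C)"
    unfolding tensor_algebra_simps(1) subset_iff using assms(3) by blast
  have "uea_ideal B br \<subseteq> uea_ideal C br \<inter> carrier (tensor_algebra B)"
  proof (rule B.uea_ideal_least)
    show "B.relator x y \<in> uea_ideal C br \<inter> carrier (tensor_algebra B)"
      if "x \<in> bspan B" "y \<in> bspan B" for x y
      using that assms(3) B.relator_closed C.relator_in_ideal by (auto simp: bspan_def)
  qed (use sub in \<open>auto simp: tensor_algebra_mult_closed tensor_algebra_add_closed
      tensor_algebra_uminus_closed tensor_algebra_zero_closed C.uea_ideal_zero C.uea_ideal_add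
      C.uea_ideal_uminus C.uea_ideal_mult\<close>)
  then show ?thesis
    unfolding uea_incl_def using assms(4) sub
    by (intro B.the_elem_class C.class_cong) auto
qed

section \<open>Characters on the tensor algebra\<close>

text \<open>The extension of \<open>\<psi>\<close> to an algebra homomorphism on the tensor algebra.\<close>

definition eval_character :: "(('b \<Rightarrow>\<^sub>0 complex) \<Rightarrow> complex) \<Rightarrow> 'b talg \<Rightarrow> complex"
  where "eval_character \<psi> p =
    (\<Sum>w\<in>Poly_Mapping.keys p. Poly_Mapping.lookup p w * (\<Prod>b\<leftarrow>letters w. \<psi> (bvec b)))"

lemma eval_character_superset:
  assumes "finite A" "Poly_Mapping.keys p \<subseteq> A"
  shows "eval_character \<psi> p = (\<Sum>w\<in>A. Poly_Mapping.lookup p w * (\<Prod>b\<leftarrow>letters w. \<psi> (bvec b)))"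
  unfolding eval_character_def
  by (rule sum.mono_neutral_left) (use assms in \<open>auto simp: in_keys_iff\<close>)

lemma eval_character_add: "eval_character \<psi> (p + q) = eval_character \<psi> p + eval_character \<psi> q"
  using keys_add[of p q]
  by (simp add: eval_character_superset[where A = "Poly_Mapping.keys p \<union> Poly_Mapping.keys q"]
      lookup_add algebra_simps sum.distrib)

lemma eval_character_single:
  "eval_character \<psi> (Poly_Mapping.single w c) = c * (\<Prod>b\<leftarrow>letters w. \<psi> (bvec b))"
  by (simp add: eval_character_superset[where A = "{w}"])

lemma eval_character_0: "eval_character \<psi> 0 = 0"
  by (simp add: eval_character_def)

lemma eval_character_uminus: "eval_character \<psi> (- p) = - eval_character \<psi> p"
  using eval_character_add[of \<psi> p "- p"] by (simp add: eval_character_0 add_eq_0_iff)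

lemma eval_character_diff: "eval_character \<psi> (p - q) = eval_character \<psi> p - eval_character \<psi> q"
  using eval_character_add[of \<psi> p "- q"] by (simp add: eval_character_uminus)

lemma eval_character_mult: "eval_character \<psi> (p * q) = eval_character \<psi> p * eval_character \<psi> q"
proof (induction p rule: scale_bvec_induct)
  case (1 w c)
  show ?case
  proof (induction q rule: scale_bvec_induct)
    case (1 w' c')
    show ?case
      by (simp add: eval_character_single mult_single plus_word_def flip: single_scale)
  qed (simp add: eval_character_add distrib_left)
qed (simp add: eval_character_add distrib_right)

lemma eval_character_tscalar: "eval_character \<psi> (tscalar c) = c"
  by (simp add: tscalar_def eval_character_single zero_word_def)

lemma eval_character_tvec:
  assumes "lie_hom_complex B br \<psi>" "x \<in> bspan B"
  shows "eval_character \<psi> (tvec x) = \<psi> x"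
proof -
  have lin: "\<psi> (scale c y) = c * \<psi> y" "\<psi> (y + z) = \<psi> y + \<psi> z"
    if "y \<in> bspan B" "z \<in> bspan B" for c y z
    using assms(1) that by (auto simp: lie_hom_complex_def)
  have b: "bvec b \<in> bspan B" if "b \<in> B" for b
    using that by (simp add: bspan_def)
  have 0: "0 \<in> bspan B" by (simp add: bspan_def)
  have psi0: "\<psi> 0 = 0"
    using lin(1)[OF 0 0, of 0] by (simp add: scale_simps)
  have "eval_character \<psi> (tvec x) = \<psi> x \<and> x \<in> bspan B"
    using assms(2)
  proof (induction x rule: update_induct)
    case const
    show ?case by (simp add: tvec_def eval_character_0 psi0 0)
  next
    case (update f a c)
    then have u: "Poly_Mapping.update a c f = f + scale c (bvec a)"
      by (intro poly_mapping_eqI)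
        (auto simp: lookup_update lookup_add lookup_single when_def in_keys_iff)
    from update have a: "a \<in> B" and f: "f \<in> bspan B"
      by (auto simp: bspan_def in_keys_iff lookup_update split: if_split_asm)
    have ac: "scale c (bvec a) \<in> bspan B"
      by (intro bspan_scale b a)
    show ?case
      using update.IH f lin(1)[OF b[OF a] f] lin(2)[OF f ac] ac
      by (simp add: u bspan_add tvec_add tvec_scale tvec_bvec eval_character_add eval_character_mult
          eval_character_tscalar eval_character_single)
  qed
  then show ?thesis ..
qed

text \<open>A character maps brackets to commutators of complex numbers, that is to 0; so the multiplicative
  extension vanishes on the relators, and its kernel is an ideal.\<close>

lemma eval_character_uea_ideal:
  assumes "closed_bracket B br" "lie_hom_complex B br \<psi>" "i \<in> uea_ideal B br"
  shows "eval_character \<psi> i = 0"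
proof -
  interpret closed_bracket B br by fact
  let ?I = "{p \<in> carrier (tensor_algebra B). eval_character \<psi> p = 0}"
  have "uea_ideal B br \<subseteq> ?I"
  proof (rule uea_ideal_least)
    fix x y assume "x \<in> bspan B" "y \<in> bspan B"
    then show "relator x y \<in> ?I"
      using assms(2) closed[of x y]
      by (auto simp: relator_closed eval_character_diff eval_character_mult lie_hom_complex_def
          eval_character_tvec[OF assms(2)])
  qed (auto simp: eval_character_0 eval_character_add eval_character_uminus eval_character_mult
      tensor_algebra_mult_closed tensor_algebra_add_closed tensor_algebra_uminus_closed
      tensor_algebra_zero_closed)
  with assms(3) show ?thesis by blast
qed

section \<open>Quotient modules and extension of scalars\<close>

text \<open>A module record extends a group record by an action; the two rules below transfer facts about
  groups to module records with the same carrier and operations.\<close>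

lemma comm_group_cong:
  assumes "comm_group G" "carrier H = carrier G" "mult H = mult G" "one H = one G"
  shows "comm_group H"
proof -
  interpret G: comm_group G by fact
  show ?thesis
    by (rule comm_groupI)
      (use assms(2-4) G.l_inv_ex in \<open>auto simp: G.m_assoc intro: G.m_comm\<close>)
qed

lemma generate_cong:
  assumes "\<And>x y. x \<otimes>\<^bsub>G\<^esub> y = x \<otimes>\<^bsub>H\<^esub> y" "\<one>\<^bsub>G\<^esub> = \<one>\<^bsub>H\<^esub>" "carrier G = carrier H"
  shows "generate G A = generate H A"
proof -
  have inv: "inv\<^bsub>G\<^esub> x = inv\<^bsub>H\<^esub> x" for x
    using assms by (simp add: m_inv_def)
  have "x \<in> generate G A \<longleftrightarrow> x \<in> generate H A" for x
  proof
    assume "x \<in> generate G A"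
    then show "x \<in> generate H A"
      by induction (simp_all add: assms inv generate.intros)
  next
    assume "x \<in> generate H A"
    then show "x \<in> generate G A"
      by induction (simp_all add: generate.intros flip: assms inv)
  qed
  then show ?thesis by blast
qed

text \<open>A left module without additivity in the scalar. The free abelian group on pairs carries such an
  action before the tensor relations are divided out.\<close>

locale ring_action = R: ring R + comm_group V
  for R :: "('r, 'x) ring_scheme" and V :: "('r, 'm) lmodule" (structure) +
  assumes act_closed [simp, intro]: "r \<in> carrier R \<Longrightarrow> x \<in> carrier V \<Longrightarrow> act V r x \<in> carrier V"
    and act_mult: "r \<in> carrier R \<Longrightarrow> x \<in> carrier V \<Longrightarrow> y \<in> carrier V \<Longrightarrow>
      act V r (x \<otimes> y) = act V r x \<otimes> act V r y"
    and act_assoc: "r \<in> carrier R \<Longrightarrow> s \<in> carrier R \<Longrightarrow> x \<in> carrier V \<Longrightarrow>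
      act V (r \<otimes>\<^bsub>R\<^esub> s) x = act V r (act V s x)"
    and act_unit: "x \<in> carrier V \<Longrightarrow> act V \<one>\<^bsub>R\<^esub> x = x"
begin

lemma act_one [simp]: "r \<in> carrier R \<Longrightarrow> act V r \<one> = \<one>"
  using act_mult[of r \<one> \<one>] by (metis act_closed l_one one_closed r_cancel_one')

lemma act_inv: "r \<in> carrier R \<Longrightarrow> x \<in> carrier V \<Longrightarrow> act V r (inv x) = inv (act V r x)"
  using act_mult[of r "inv x" x] by (intro inv_equality[symmetric]) auto

end

locale left_module = ring_action +
  assumes act_add: "r \<in> carrier R \<Longrightarrow> s \<in> carrier R \<Longrightarrow> x \<in> carrier V \<Longrightarrow>
    act V (r \<oplus>\<^bsub>R\<^esub> s) x = act V r x \<otimes> act V s x"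
begin

lemma act_zero: "x \<in> carrier V \<Longrightarrow> act V \<zero>\<^bsub>R\<^esub> x = \<one>"
  using act_add[of "\<zero>\<^bsub>R\<^esub>" "\<zero>\<^bsub>R\<^esub>" x] by (metis R.add.l_one R.zero_closed act_closed r_cancel_one')

lemma act_minus:
  assumes "r \<in> carrier R" "s \<in> carrier R" "x \<in> carrier V"
  shows "act V (r \<ominus>\<^bsub>R\<^esub> s) x = act V r x \<otimes> inv (act V s x)"
proof -
  have "act V (\<ominus>\<^bsub>R\<^esub> s) x \<otimes> act V s x = \<one>"
    using assms act_add[of "\<ominus>\<^bsub>R\<^esub> s" s x] by (simp add: R.l_neg act_zero)
  then have "act V (\<ominus>\<^bsub>R\<^esub> s) x = inv (act V s x)"
    using assms by (intro inv_equality[symmetric]) auto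
  then show ?thesis
    using assms act_add[of r "\<ominus>\<^bsub>R\<^esub> s" x] by (simp add: a_minus_def)
qed

end

locale stable_subgroup = ring_action +
  fixes N
  assumes subgroup: "subgroup N V"
    and stable: "r \<in> carrier R \<Longrightarrow> n \<in> N \<Longrightarrow> act V r n \<in> N"
begin

lemma normal: "N \<lhd> V"
  using subgroup by (rule subgroup_imp_normal)

lemma coset_eq_iff: "x \<in> carrier V \<Longrightarrow> y \<in> carrier V \<Longrightarrow> N #> x = N #> y \<longleftrightarrow> x \<otimes> inv y \<in> N"
  by (metis is_group rcos_self repr_independence subgroup subgroup.rcos_module)

lemma coset_eq_self_iff: "x \<in> carrier V \<Longrightarrow> N #> x = N \<longleftrightarrow> x \<in> N"
  by (metis is_group rcos_self subgroup subgroup.rcos_const)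

lemma carrier_quot: "carrier (quot_module V N) = (\<lambda>x. N #> x) ` carrier V"
  by (simp add: quot_module_def carrier_FactGroup)

lemma mult_quot:
  "x \<in> carrier V \<Longrightarrow> y \<in> carrier V \<Longrightarrow> (N #> x) \<otimes>\<^bsub>quot_module V N\<^esub> (N #> y) = N #> (x \<otimes> y)"
  by (simp add: quot_module_def normal.rcos_sum[OF normal])

lemma one_quot: "\<one>\<^bsub>quot_module V N\<^esub> = N"
  by (simp add: quot_module_def)

lemma act_quot:
  assumes r: "r \<in> carrier R" and x: "x \<in> carrier V"
  shows "act (quot_module V N) r (N #> x) = N #> act V r x"
proof -
  have eq: "N #> act V r y = N #> act V r x" if "y \<in> N #> x" for y
  proof -
    from that obtain n where n: "n \<in> N" "y = n \<otimes> x"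
      by (auto simp: r_coset_def)
    then have nV: "n \<in> carrier V" using subgroup subgroup.mem_carrier by metis
    have "N #> act V r y = (N #> act V r n) #> act V r x"
      using r x n nV subgroup by (simp add: act_mult coset_mult_assoc subgroup.subset)
    also have "N #> act V r n = N"
      using r n nV stable by (simp add: coset_eq_self_iff)
    finally show ?thesis .
  qed
  have "x \<in> N #> x"
    using x subgroup by (rule rcos_self)
  then show ?thesis
    unfolding quot_module_def lmodule.simps
    by (intro the_elem_image_unique) (blast, erule eq)
qed

lemma ring_action_quot: "ring_action R (quot_module V N)"
proof -
  have "comm_group (quot_module V N)"
    by (rule comm_group_cong[OF abelian_FactGroup[OF subgroup]]) (simp_all add: quot_module_def)
  then show ?thesis
    by (intro ring_action.intro R.ring_axioms ring_action_axioms.intro)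
      (auto simp: carrier_quot act_quot mult_quot act_mult act_assoc act_unit)
qed

text \<open>Additivity in the scalar may hold modulo \<open>N\<close> only; this is what turns the action on the free
  abelian group on pairs into a module structure on the tensor product.\<close>

lemma left_module_quot:
  assumes "\<And>r s x. r \<in> carrier R \<Longrightarrow> s \<in> carrier R \<Longrightarrow> x \<in> carrier V \<Longrightarrow>
    N #> act V (r \<oplus>\<^bsub>R\<^esub> s) x = N #> (act V r x \<otimes> act V s x)"
  shows "left_module R (quot_module V N)"
  by (intro left_module.intro ring_action_quot left_module_axioms.intro)
    (auto simp: carrier_quot act_quot mult_quot assms)

end

locale scalar_extension = R: ring R
  for S :: "('s, 'y) ring_scheme" and f :: "'s \<Rightarrow> 'r" and R :: "('r, 'x) ring_scheme"
    and V :: "('s, 'v) lmodule" +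
  assumes f_closed: "s \<in> carrier S \<Longrightarrow> f s \<in> carrier R"
    and V_mult_closed: "v \<in> carrier V \<Longrightarrow> v' \<in> carrier V \<Longrightarrow> v \<otimes>\<^bsub>V\<^esub> v' \<in> carrier V"
    and V_act_closed: "s \<in> carrier S \<Longrightarrow> v \<in> carrier V \<Longrightarrow> act V s v \<in> carrier V"
begin

abbreviation "F \<equiv> free_pairs R V"
abbreviation "N \<equiv> tensor_subgroup S f R V"
abbreviation "W \<equiv> tensor_module S f R V"
abbreviation "pure \<equiv> pure_tensor S f R V"

lemma free_pairs_simps:
  "c \<in> carrier F \<longleftrightarrow> Poly_Mapping.keys c \<subseteq> carrier R \<times> carrier V"
  "c \<otimes>\<^bsub>F\<^esub> d = c + d" "\<one>\<^bsub>F\<^esub> = 0"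
  "act F r = frag_extend (\<lambda>(r', v). frag_of (r \<otimes>\<^bsub>R\<^esub> r', v))"
  by (simp_all add: free_pairs_def Let_def)

lemma comm_group_free_pairs: "comm_group F"
  by (rule comm_group_cong[OF abelian_free_Abelian_group]) (simp_all add: free_pairs_def Let_def)

lemma free_pairs_diff: "a \<in> carrier F \<Longrightarrow> b \<in> carrier F \<Longrightarrow> a - b \<in> carrier F"
  using keys_diff[of a b] by (auto simp: free_pairs_simps)

lemma inv_free_pairs: "c \<in> carrier F \<Longrightarrow> inv\<^bsub>F\<^esub> c = - c"
  using comm_group.axioms(2)[OF comm_group_free_pairs]
  by (intro group.inv_equality) (auto simp: free_pairs_simps)

lemma free_pairs_induct [consumes 1, case_names zero pair diff]:
  assumes c: "c \<in> carrier F" and "P 0"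
    and "\<And>r v. r \<in> carrier R \<Longrightarrow> v \<in> carrier V \<Longrightarrow> P (frag_of (r, v))"
    and "\<And>a b. a \<in> carrier F \<Longrightarrow> b \<in> carrier F \<Longrightarrow> P a \<Longrightarrow> P b \<Longrightarrow> P (a - b)"
  shows "P c"
proof -
  have "c \<in> carrier F \<and> P c"
    using c[unfolded free_pairs_simps]
  proof (induction c rule: frag_induction)
    case (diff a b)
    then show ?case by (simp add: assms free_pairs_diff)
  qed (auto simp: free_pairs_simps assms)
  then show ?thesis ..
qed

lemma act_frag_of: "act F r (frag_of (r', v)) = frag_of (r \<otimes>\<^bsub>R\<^esub> r', v)"
  by (simp add: free_pairs_simps)

lemma act_diff: "act F r (a - b) = act F r a - act F r b"
  by (simp add: free_pairs_simps frag_extend_diff)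

lemma ring_action_free_pairs: "ring_action R F"
proof (intro ring_action.intro R.ring_axioms comm_group_free_pairs ring_action_axioms.intro)
  fix r x assume r: "r \<in> carrier R" and x: "x \<in> carrier F"
  from x show "act F r x \<in> carrier F"
  proof (induction rule: free_pairs_induct)
    case (diff a b)
    then show ?case by (simp add: act_diff free_pairs_diff)
  qed (use r in \<open>auto simp: free_pairs_simps\<close>)
  show "act F r (x \<otimes>\<^bsub>F\<^esub> y) = act F r x \<otimes>\<^bsub>F\<^esub> act F r y" for y
    by (simp add: free_pairs_simps frag_extend_add)
  show "act F (r \<otimes>\<^bsub>R\<^esub> s) x = act F r (act F s x)" if "s \<in> carrier R" for s
    using x
  proof (induction rule: free_pairs_induct)
    case (pair r' v)
    then show ?case using r that by (simp add: act_frag_of R.m_assoc)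
  qed (simp_all add: act_diff, simp add: free_pairs_simps)
next
  show "act F \<one>\<^bsub>R\<^esub> x = x" if "x \<in> carrier F" for x
    using that
  proof (induction rule: free_pairs_induct)
    case (pair r' v)
    then show ?case by (simp add: act_frag_of)
  qed (simp_all add: act_diff, simp add: free_pairs_simps)
qed

lemma relations_in_free_pairs: "tensor_relations S f R V \<subseteq> carrier F"
  unfolding tensor_relations_def
  by (auto intro!: free_pairs_diff simp: f_closed V_mult_closed V_act_closed)
    (auto simp: free_pairs_simps f_closed V_mult_closed V_act_closed)

lemma tensor_subgroup_eq: "N = generate F (tensor_relations S f R V)"
  unfolding tensor_subgroup_def
  by (rule generate_cong) (simp_all add: free_pairs_def Let_def)

lemma relation_in_N: "c \<in> tensor_relations S f R V \<Longrightarrow> c \<in> N"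
  by (simp add: tensor_subgroup_eq generate.incl)

text \<open>Left multiplication of the ring component turns each tensor relation into another one of the
  same kind; hence the subgroup that they generate is stable.\<close>

lemma act_relation:
  assumes "r \<in> carrier R" "c \<in> tensor_relations S f R V"
  shows "act F r c \<in> tensor_relations S f R V"
  using assms(2) unfolding tensor_relations_def
proof (elim UnE, goal_cases)
  case 1
  then obtain r' s' v where "c = frag_of (r' \<oplus>\<^bsub>R\<^esub> s', v) - frag_of (r', v) - frag_of (s', v)"
    "r' \<in> carrier R" "s' \<in> carrier R" "v \<in> carrier V" by blast
  moreover from this have "act F r c = frag_of ((r \<otimes>\<^bsub>R\<^esub> r') \<oplus>\<^bsub>R\<^esub> (r \<otimes>\<^bsub>R\<^esub> s'), v)
      - frag_of (r \<otimes>\<^bsub>R\<^esub> r', v) - frag_of (r \<otimes>\<^bsub>R\<^esub> s', v)"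
    using assms(1) by (simp only: act_diff act_frag_of R.r_distr)
  moreover have "r \<otimes>\<^bsub>R\<^esub> r' \<in> carrier R" "r \<otimes>\<^bsub>R\<^esub> s' \<in> carrier R"
    using assms(1) calculation by simp_all
  ultimately show ?case by blast
next
  case 2
  then obtain r' v v' where "c = frag_of (r', v \<otimes>\<^bsub>V\<^esub> v') - frag_of (r', v) - frag_of (r', v')"
    "r' \<in> carrier R" "v \<in> carrier V" "v' \<in> carrier V" by blast
  moreover from this have "act F r c = frag_of (r \<otimes>\<^bsub>R\<^esub> r', v \<otimes>\<^bsub>V\<^esub> v')
      - frag_of (r \<otimes>\<^bsub>R\<^esub> r', v) - frag_of (r \<otimes>\<^bsub>R\<^esub> r', v')"
    by (simp only: act_diff act_frag_of)
  moreover have "r \<otimes>\<^bsub>R\<^esub> r' \<in> carrier R"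
    using assms(1) calculation by simp
  ultimately show ?case by blast
next
  case 3
  then obtain r' s v where "c = frag_of (r' \<otimes>\<^bsub>R\<^esub> f s, v) - frag_of (r', act V s v)"
    "r' \<in> carrier R" "s \<in> carrier S" "v \<in> carrier V" by blast
  moreover from this have "act F r c
      = frag_of ((r \<otimes>\<^bsub>R\<^esub> r') \<otimes>\<^bsub>R\<^esub> f s, v) - frag_of (r \<otimes>\<^bsub>R\<^esub> r', act V s v)"
    using assms(1) by (simp only: act_diff act_frag_of R.m_assoc f_closed)
  moreover have "r \<otimes>\<^bsub>R\<^esub> r' \<in> carrier R"
    using assms(1) calculation by simp
  ultimately show ?case by blast
qed

sublocale F: ring_action R F
  by (rule ring_action_free_pairs)

sublocale N: stable_subgroup R F N
proof (intro stable_subgroup.intro ring_action_free_pairs stable_subgroup_axioms.intro)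
  show "subgroup N F"
    unfolding tensor_subgroup_eq by (rule F.generate_is_subgroup[OF relations_in_free_pairs])
  fix r n assume r: "r \<in> carrier R"
  assume "n \<in> N"
  then show "act F r n \<in> N"
    unfolding tensor_subgroup_eq
  proof induction
    case (inv h)
    then show ?case
      using relations_in_free_pairs act_relation[OF r]
      by (subst F.act_inv[OF r]) (auto intro!: generate.inv)
  next
    case (eng h1 h2)
    then show ?case
      using F.generate_in_carrier[OF relations_in_free_pairs]
      by (auto simp: F.act_mult[OF r] intro!: generate.eng)
  qed (auto simp: F.act_one[OF r] act_relation[OF r] intro: generate.one generate.incl)
qed

lemma coset_eqI: "a - b \<in> N \<Longrightarrow> a \<in> carrier F \<Longrightarrow> b \<in> carrier F \<Longrightarrow> N #>\<^bsub>F\<^esub> a = N #>\<^bsub>F\<^esub> b"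
  by (simp add: N.coset_eq_iff inv_free_pairs free_pairs_simps(2))

text \<open>On a pair, additivity in the scalar is one of the tensor relations; differences of pairs follow
  since both sides are additive in the vector.\<close>

lemma left_module_tensor: "left_module R W"
  unfolding tensor_module_def
proof (rule N.left_module_quot)
  fix r s x assume r: "r \<in> carrier R" and s: "s \<in> carrier R" and x: "x \<in> carrier F"
  have sum: "act F r x + act F s x \<in> carrier F" if "x \<in> carrier F" for x
    using F.m_closed[OF F.act_closed[OF r that] F.act_closed[OF s that]]
    by (simp only: free_pairs_simps(2))
  from x have "act F (r \<oplus>\<^bsub>R\<^esub> s) x - (act F r x + act F s x) \<in> N"
  proof (induction rule: free_pairs_induct)
    case zero
    then show ?case using subgroup.one_closed[OF N.subgroup] by (simp add: free_pairs_simps)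
  next
    case (pair r' v)
    have "frag_of ((r \<otimes>\<^bsub>R\<^esub> r') \<oplus>\<^bsub>R\<^esub> (s \<otimes>\<^bsub>R\<^esub> r'), v) - frag_of (r \<otimes>\<^bsub>R\<^esub> r', v) - frag_of (s \<otimes>\<^bsub>R\<^esub> r', v) \<in> N"
      using r s pair by (intro relation_in_N) (unfold tensor_relations_def, blast)
    then show ?case
      using r s pair by (simp add: act_frag_of R.l_distr algebra_simps)
  next
    case (diff a b)
    let ?d = "\<lambda>x. act F (r \<oplus>\<^bsub>R\<^esub> s) x - (act F r x + act F s x)"
    have "?d b \<in> carrier F"
      using subgroup.mem_carrier[OF N.subgroup diff.IH(2)] .
    then have "?d a - ?d b \<in> N"
      using subgroup.m_closed[OF N.subgroup diff.IH(1) subgroup.m_inv_closed[OF N.subgroup diff.IH(2)]]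
      by (simp only: inv_free_pairs free_pairs_simps(2) add_uminus_conv_diff)
    then show ?case by (simp add: act_diff algebra_simps)
  qed
  then show "N #>\<^bsub>F\<^esub> act F (r \<oplus>\<^bsub>R\<^esub> s) x = N #>\<^bsub>F\<^esub> (act F r x \<otimes>\<^bsub>F\<^esub> act F s x)"
    unfolding free_pairs_simps(2)
    using r s x by (intro coset_eqI sum) auto
qed

lemma pair_in_F: "r \<in> carrier R \<Longrightarrow> v \<in> carrier V \<Longrightarrow> frag_of (r, v) \<in> carrier F"
  by (simp add: free_pairs_simps)

lemma pure_closed: "r \<in> carrier R \<Longrightarrow> v \<in> carrier V \<Longrightarrow> pure r v \<in> carrier W"
  by (auto simp: tensor_module_def N.carrier_quot pure_tensor_def pair_in_F)

lemma act_pure: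
  "r \<in> carrier R \<Longrightarrow> r' \<in> carrier R \<Longrightarrow> v \<in> carrier V \<Longrightarrow> act W r (pure r' v) = pure (r \<otimes>\<^bsub>R\<^esub> r') v"
  by (simp add: tensor_module_def pure_tensor_def N.act_quot pair_in_F act_frag_of)

lemma pure_balanced:
  assumes "r \<in> carrier R" "s \<in> carrier S" "v \<in> carrier V"
  shows "pure (r \<otimes>\<^bsub>R\<^esub> f s) v = pure r (act V s v)"
  unfolding pure_tensor_def
proof (intro coset_eqI)
  show "frag_of (r \<otimes>\<^bsub>R\<^esub> f s, v) - frag_of (r, act V s v) \<in> N"
    using assms by (intro relation_in_N) (unfold tensor_relations_def, blast)
qed (use assms in \<open>auto simp: pair_in_F f_closed V_act_closed\<close>)

text \<open>If \<open>v\<close> generates the inner module then every inner vector can be moved across the tensor sign,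
  so every pure tensor, and with it every tensor, is a multiple of \<open>1 \<otimes> v\<close>.\<close>

lemma tensor_cyclic:
  assumes v: "v \<in> carrier V" and cyclic: "\<And>u. u \<in> carrier V \<Longrightarrow> \<exists>s\<in>carrier S. act V s v = u"
    and x: "x \<in> carrier W"
  shows "\<exists>r\<in>carrier R. x = act W r (pure \<one>\<^bsub>R\<^esub> v)"
proof -
  interpret W: left_module R W by (rule left_module_tensor)
  have w: "pure \<one>\<^bsub>R\<^esub> v \<in> carrier W"
    using v by (simp add: pure_closed)
  obtain c where c: "c \<in> carrier F" and x: "x = N #>\<^bsub>F\<^esub> c"
    using x by (auto simp: tensor_module_def N.carrier_quot)
  from c have "\<exists>r\<in>carrier R. N #>\<^bsub>F\<^esub> c = act W r (pure \<one>\<^bsub>R\<^esub> v)"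
  proof (induction rule: free_pairs_induct)
    case zero
    have "N #>\<^bsub>F\<^esub> 0 = N"
      using subgroup.one_closed[OF N.subgroup] by (subst N.coset_eq_self_iff) (auto simp: free_pairs_simps)
    then show ?case
      using W.act_zero[OF w] by (auto intro!: bexI[of _ "\<zero>\<^bsub>R\<^esub>"] simp: tensor_module_def N.one_quot)
  next
    case (pair r u)
    then obtain s where "s \<in> carrier S" "act V s v = u"
      using cyclic by blast
    then have rs: "r \<otimes>\<^bsub>R\<^esub> f s \<in> carrier R"
      using pair by (simp add: f_closed)
    have "act W (r \<otimes>\<^bsub>R\<^esub> f s) (pure \<one>\<^bsub>R\<^esub> v) = pure (r \<otimes>\<^bsub>R\<^esub> f s) v"
      using act_pure[OF rs R.one_closed v] R.r_one[OF rs] by simp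
    also have "\<dots> = pure r u"
      using pure_balanced[OF pair(1) \<open>s \<in> carrier S\<close> v] \<open>act V s v = u\<close> by simp
    finally have "pure r u = act W (r \<otimes>\<^bsub>R\<^esub> f s) (pure \<one>\<^bsub>R\<^esub> v)" ..
    then show ?case
      using rs unfolding pure_tensor_def by blast
  next
    case (diff a b)
    then obtain r s where r: "r \<in> carrier R" "N #>\<^bsub>F\<^esub> a = act W r (pure \<one>\<^bsub>R\<^esub> v)"
      and s: "s \<in> carrier R" "N #>\<^bsub>F\<^esub> b = act W s (pure \<one>\<^bsub>R\<^esub> v)" by blast
    have "(N #>\<^bsub>F\<^esub> (a - b)) \<otimes>\<^bsub>W\<^esub> (N #>\<^bsub>F\<^esub> b) = N #>\<^bsub>F\<^esub> a"
      unfolding tensor_module_def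
      using N.mult_quot[OF free_pairs_diff[OF diff.hyps] diff.hyps(2)]
      by (simp add: free_pairs_simps(2))
    moreover have "N #>\<^bsub>F\<^esub> (a - b) \<in> carrier W"
      using diff by (simp add: tensor_module_def N.carrier_quot free_pairs_diff)
    ultimately have "N #>\<^bsub>F\<^esub> (a - b) = act W (r \<ominus>\<^bsub>R\<^esub> s) (pure \<one>\<^bsub>R\<^esub> v)"
      using r s w by (simp add: W.act_minus W.inv_solve_right)
    then show ?case using r s by blast
  qed
  then show ?thesis using x by simp
qed

end

section \<open>Weights\<close>

text \<open>The weight is, up to a shift that depends on the kind of the basis vector, minus its argument. The
  shifts 3, 0 and 1 are chosen such that every bracket lowers the total weight by the same amount, so
  that bracket terms are of lower order, while the generators of the module have positive weight.\<close>

fun weight :: "sv_basis \<Rightarrow> int" where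
  "weight (L n) = 3 - n"
| "weight (M n) = - n"
| "weight (Y n) = 1 - n"

text \<open>The basis vectors outside \<open>sv_plus\<close> except the central \<open>M 0\<close>, which acts by a scalar; these
  generate the module from the cyclic vector.\<close>

definition sv_minus_basis :: "sv_basis set"
  where "sv_minus_basis = {L n | n. n \<le> 0} \<union> {M n | n. n \<le> - 1} \<union> {Y n | n. n \<le> - 1}"

lemma sv_basis_cases: "b \<in> sv_minus_basis \<or> b = M 0 \<or> b \<in> sv_plus_basis"
  by (cases b) (auto simp: sv_minus_basis_def sv_plus_basis_def)

lemma sv_minus_weight: "b \<in> sv_minus_basis \<Longrightarrow> weight b \<ge> 1"
  by (auto simp: sv_minus_basis_def)

text \<open>If the bracket is 0, then \<open>k = 0\<close> and \<open>e\<close> is an arbitrary basis vector of the right weight.\<close>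

lemma sv_bracket_weight:
  obtains k e where "sv_basis_bracket a b = scale k (bvec e)" "weight e = weight a + weight b - 3"
proof -
  let ?ok = "\<lambda>e. weight e = weight a + weight b - 3"
  have zero: "\<exists>e. ?ok e"
    by (rule exI[of _ "L (6 - weight a - weight b)"]) simp
  have "\<exists>k e. sv_basis_bracket a b = scale k (bvec e) \<and> ?ok e"
  proof (cases "sv_basis_bracket a b = 0")
    case True
    then show ?thesis using zero by (metis scale_simps(4))
  next
    case False
    then show ?thesis
      by (cases a; cases b; simp add: scale_simps(8)) (rule exI, rule exI, rule conjI, rule refl, simp)+
  qed
  then show ?thesis using that by blast
qed

lemma sv_minus_bracket:
  assumes "a \<in> sv_minus_basis" "b \<in> sv_minus_basis" "sv_basis_bracket a b = scale k (bvec e)" "k \<noteq> 0"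
  shows "e \<in> sv_minus_basis"
proof -
  have "Poly_Mapping.lookup (sv_basis_bracket a b) e \<noteq> 0"
    using assms by simp
  then show ?thesis
    using assms(1,2) by (auto simp: sv_minus_basis_def lookup_single when_def split: if_split_asm)
qed

text \<open>The basis vector whose bracket with the given one is a nonzero multiple of \<open>M 1\<close>.\<close>

fun partner :: "sv_basis \<Rightarrow> sv_basis" where
  "partner (L n) = M (1 - n)"
| "partner (M n) = L (1 - n)"
| "partner (Y n) = Y (- n)"

definition M1_coeff :: "sv_basis \<Rightarrow> sv_basis \<Rightarrow> complex"
  where "M1_coeff a b = Poly_Mapping.lookup (sv_basis_bracket a b) (M 1)"

lemma weight_partner: "weight (partner b) = 2 - weight b"
  by (cases b) simp_all

lemma partner_plus: "b \<in> sv_minus_basis \<Longrightarrow> partner b \<in> sv_plus_basis"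
  by (auto simp: sv_minus_basis_def sv_plus_basis_def)

lemma M1_coeff_partner: "b \<in> sv_minus_basis \<Longrightarrow> M1_coeff (partner b) b \<noteq> 0"
  by (auto simp: sv_minus_basis_def M1_coeff_def lookup_single)

text \<open>Taking brackets with the partner of \<open>b\<close> detects \<open>b\<close> alone, as a partial derivative does. This
  makes the Euler operator diagonal to leading order.\<close>

lemma M1_coeff_partner_other:
  "b \<in> sv_minus_basis \<Longrightarrow> b' \<in> sv_minus_basis \<Longrightarrow> b' \<noteq> b \<Longrightarrow> M1_coeff (partner b) b' = 0"
  by (auto simp: sv_minus_basis_def M1_coeff_def lookup_single when_def split: if_split_asm)

lemma finite_sv_minus: "finite {b \<in> sv_minus_basis. weight b \<le> N}"
proof -
  have "{b \<in> sv_minus_basis. weight b \<le> N} \<subseteq> L ` {-N..0} \<union> M ` {-N..0} \<union> Y ` {-N..0}"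
    by (auto simp: sv_minus_basis_def)
  then show ?thesis by (rule finite_subset) auto
qed

text \<open>Each of these vectors is a nonzero multiple of a bracket of \<open>L 1\<close> with another vector of
  \<open>sv_plus\<close>, and characters vanish on brackets. The exception \<open>M 1\<close> is the source of the leading
  terms below.\<close>

lemma character_zero:
  assumes "sv_plus_character \<psi>" "b \<in> sv_plus_basis" "weight b < 0" "b \<noteq> M 1"
  shows "\<psi> (bvec b) = 0"
proof -
  have in_plus: "bvec a \<in> bspan sv_plus_basis" if "a \<in> sv_plus_basis" for a
    using that by (simp add: bspan_def)
  have zero: "\<psi> (bvec e) = 0"
    if "a \<in> sv_plus_basis" "e' \<in> sv_plus_basis" "e \<in> sv_plus_basis"
      "sv_basis_bracket a e' = scale k (bvec e)" "k \<noteq> 0" for a e' e k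
  proof -
    have "\<psi> (sv_bracket (bvec a) (bvec e')) = 0"
      using assms(1) in_plus that(1,2) unfolding lie_hom_complex_def by auto
    then have "k * \<psi> (bvec e) = 0"
      using assms(1) in_plus that(3,4) unfolding lie_hom_complex_def
      by (simp add: sv_bracket_def bilinear_ext_bvec)
    then show ?thesis using that(5) by simp
  qed
  show ?thesis
  proof (cases b)
    case (L n)
    with assms(3) have "n \<ge> 4" by simp
    then show ?thesis unfolding L
      by (intro zero[of "L 1" "L (n - 1)" _ "of_int (n - 2)"])
        (auto simp: sv_plus_basis_def simp flip: of_int_diff)
  next
    case (M n)
    with assms(2,4) have "n \<ge> 2" by (auto simp: sv_plus_basis_def)
    then show ?thesis unfolding M
      by (intro zero[of "L 1" "M (n - 1)" _ "of_int (n - 1)"])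
        (auto simp: sv_plus_basis_def)
  next
    case (Y n)
    with assms(3) have "n \<ge> 2" by simp
    then show ?thesis unfolding Y
      by (intro zero[of "L 1" "Y (n - 1)" _ "of_int (n - 1)"])
        (auto simp: sv_plus_basis_def)
  qed
qed

section \<open>The weight filtration and the Euler operator\<close>

text \<open>The left ideal \<open>J\<close> stands for the annihilator of the cyclic vector: elements of the tensor
  algebra that differ by an element of \<open>J\<close> represent the same vector of the module. The bracket and
  central relations hold on every vector, hence the factor \<open>p\<close>; the relations for \<open>sv_plus\<close> hold on
  the cyclic vector only.\<close>

locale whittaker_ideal =
  fixes \<psi> :: "sv \<Rightarrow> complex" and \<xi> :: complex and J :: "sv_basis talg set"
  assumes character: "sv_plus_character \<psi>"
    and M1_nonzero: "\<psi> (bvec (M 1)) \<noteq> 0"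
    and J_zero: "0 \<in> J"
    and J_add: "p \<in> J \<Longrightarrow> q \<in> J \<Longrightarrow> p + q \<in> J"
    and J_left_mult: "p \<in> J \<Longrightarrow> q * p \<in> J"
    and J_bracket: "(letter a * letter b - letter b * letter a - tvec (sv_basis_bracket a b)) * p \<in> J"
    and J_central: "(letter (M 0) - tscalar \<xi>) * p \<in> J"
    and J_generator: "b \<in> sv_plus_basis \<Longrightarrow> letter b - tscalar (\<psi> (bvec b)) \<in> J"
begin

text \<open>The filtration by total weight, pulled back to the tensor algebra. The words are not ordered, and
  \<open>d\<close> may be negative, in which case only \<open>J\<close> remains.\<close>

inductive deg_le :: "sv_basis talg \<Rightarrow> int \<Rightarrow> bool"  (infix "deg\<le>" 50) where
  ideal: "p \<in> J \<Longrightarrow> p deg\<le> d"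
| scalar: "0 \<le> d \<Longrightarrow> tscalar c deg\<le> d"
| add: "p deg\<le> d \<Longrightarrow> q deg\<le> d \<Longrightarrow> p + q deg\<le> d"
| step: "b \<in> sv_minus_basis \<Longrightarrow> p deg\<le> d - weight b \<Longrightarrow> letter b * p deg\<le> d"

lemma deg_le_mono: "p deg\<le> d \<Longrightarrow> d \<le> d' \<Longrightarrow> p deg\<le> d'"
  by (induction arbitrary: d' rule: deg_le.induct) (auto intro: deg_le.intros)

lemma deg_le_tscalar: "p deg\<le> d \<Longrightarrow> tscalar c * p deg\<le> d"
proof (induction rule: deg_le.induct)
  case (scalar d c')
  then show ?case by (metis deg_le.scalar tscalar_simps(6))
next
  case (step b p d)
  then show ?case by (metis deg_le.step tscalar_left_commute)
qed (auto intro: deg_le.intros J_left_mult simp: distrib_left)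

lemma deg_le_zero: "0 deg\<le> d"
  by (rule deg_le.ideal[OF J_zero])

lemma deg_le_uminus: "p deg\<le> d \<Longrightarrow> - p deg\<le> d"
  using deg_le_tscalar[of p d "- 1"] by (simp add: tscalar_simps)

lemma deg_le_diff: "p deg\<le> d \<Longrightarrow> q deg\<le> d \<Longrightarrow> p - q deg\<le> d"
  using deg_le.add[of p d "- q"] by (simp add: deg_le_uminus)

lemma deg_le_sum: "(\<And>i. i \<in> A \<Longrightarrow> f i deg\<le> d) \<Longrightarrow> sum f A deg\<le> d"
  by (induction A rule: infinite_finite_induct) (simp_all add: deg_le_zero deg_le.add)

lemma deg_le_cong: "p - q deg\<le> d \<Longrightarrow> q deg\<le> d \<Longrightarrow> p deg\<le> d"
  using deg_le.add[of "p - q" d q] by simp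

lemma deg_le_letter: "b \<in> sv_minus_basis \<Longrightarrow> p deg\<le> d \<Longrightarrow> letter b * p deg\<le> d + weight b"
  by (rule deg_le.step) auto

text \<open>Every letter in a word has weight at least 1, so only the empty word has degree 0 and no word has
  negative degree.\<close>

lemma deg_le_nonpos:
  "p deg\<le> d \<Longrightarrow> (d < 0 \<longrightarrow> p \<in> J) \<and> (d \<le> 0 \<longrightarrow> (\<exists>c. p - tscalar c \<in> J))"
proof (induction rule: deg_le.induct)
  case (ideal p d)
  then show ?case by (metis diff_zero tscalar_simps(1))
next
  case (scalar d c)
  then show ?case by (auto intro!: exI[of _ c] J_zero)
next
  case (add p d q)
  have "\<exists>c. p + q - tscalar c \<in> J" if d: "d \<le> 0"
  proof -
    obtain c c' where "p - tscalar c \<in> J" "q - tscalar c' \<in> J"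
      using add.IH d by auto
    then have "p + q - tscalar (c + c') \<in> J"
      using J_add[of "p - tscalar c" "q - tscalar c'"]
      by (simp add: tscalar_simps algebra_simps)
    then show ?thesis ..
  qed
  then show ?case
    using add.IH J_add by auto
next
  case (step b p d)
  have "letter b * p \<in> J" if "d \<le> 0"
    using step.IH sv_minus_weight[OF step.hyps(1)] that by (simp add: J_left_mult)
  then show ?case
    by (metis diff_zero order_less_imp_le tscalar_simps(1))
qed

text \<open>The failure of \<open>p\<close> to be a Whittaker vector for \<open>x\<close>; to leading order it acts as a
  derivation.\<close>

definition deviation :: "sv_basis \<Rightarrow> sv_basis talg \<Rightarrow> sv_basis talg"
  where "deviation x p = (letter x - tscalar (\<psi> (bvec x))) * p"

lemma deviation_simps:
  "deviation x (p + q) = deviation x p + deviation x q"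
  "deviation x (tscalar c * p) = tscalar c * deviation x p"
  "deviation x (tscalar c) = tscalar c * (letter x - tscalar (\<psi> (bvec x)))"
  by (simp_all add: deviation_def distrib_left tscalar_left_commute flip: tscalar_commute)

text \<open>Applying a letter raises the degree by at most its weight, with the single exception of \<open>M 1\<close>:
  it has weight \<open>- 1\<close> but acts as a nonzero scalar up to lower order. All other basis vectors of
  \<open>sv_plus\<close> on which \<open>\<psi>\<close> does not vanish have nonnegative weight, and so does \<open>M 0\<close>. The bound on the deviations, proved
  below by induction, is a hypothesis here because this lemma supplies its induction step.\<close>

lemma letter_deg_le:
  assumes p: "p deg\<le> d"
    and dev: "\<And>x. x \<in> sv_plus_basis \<Longrightarrow> deviation x p deg\<le> d + weight x - 2"
  shows "letter e * p - tscalar (if e = M 1 then \<psi> (bvec (M 1)) else 0) * p deg\<le> d + weight e"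
proof -
  consider "e \<in> sv_minus_basis" | "e = M 0" | "e \<in> sv_plus_basis"
    using sv_basis_cases by blast
  then show ?thesis
  proof cases
    case 1
    then show ?thesis
      using deg_le_letter[OF 1 p] by (auto simp: tscalar_simps sv_minus_basis_def)
  next
    case 2
    have "letter e * p - tscalar \<xi> * p deg\<le> d"
      using J_central[of p] 2 by (auto intro: deg_le.ideal simp: left_diff_distrib)
    then show ?thesis
      using deg_le_cong[OF _ deg_le_tscalar[OF p]] 2 by (simp add: tscalar_simps)
  next
    case 3
    have d: "deviation e p deg\<le> d + weight e"
      by (rule deg_le_mono[OF dev[OF 3]]) simp
    show ?thesis
    proof (cases "e = M 1")
      case True
      then show ?thesis using d by (simp add: deviation_def left_diff_distrib)
    next
      case False
      have "tscalar (\<psi> (bvec e)) * p deg\<le> d + weight e"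
      proof (cases "weight e < 0")
        case True
        then show ?thesis
          using character_zero[OF character 3 True False] by (simp add: tscalar_simps deg_le_zero)
      next
        case nonneg: False
        show ?thesis
          by (rule deg_le_mono[OF deg_le_tscalar[OF p]]) (use nonneg in simp)
      qed
      with d have "letter e * p deg\<le> d + weight e"
        unfolding deviation_def left_diff_distrib by (rule deg_le_cong)
      with False show ?thesis by (simp add: tscalar_simps)
    qed
  qed
qed

text \<open>The constant by which the bracket of \<open>x\<close> and \<open>b\<close> acts to leading order.\<close>

abbreviation pairing :: "sv_basis \<Rightarrow> sv_basis \<Rightarrow> complex"
  where "pairing x b \<equiv> M1_coeff x b * \<psi> (bvec (M 1))"

text \<open>The product rule for the deviation, from \<open>x b = b x + [x, b]\<close>: the bracket acts by the scalar
  \<open>pairing x b\<close> up to terms of lower degree.\<close>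

lemma deviation_letter:
  assumes p: "p deg\<le> d"
    and dev: "\<And>x. x \<in> sv_plus_basis \<Longrightarrow> deviation x p deg\<le> d + weight x - 2"
  shows "deviation x (letter b * p) - letter b * deviation x p - tscalar (pairing x b) * p
    deg\<le> d + weight x + weight b - 3"
proof -
  obtain k e where ke: "sv_basis_bracket x b = scale k (bvec e)"
    and w: "weight e = weight x + weight b - 3"
    by (rule sv_bracket_weight)
  have "pairing x b = k * (if e = M 1 then \<psi> (bvec (M 1)) else 0)"
    by (simp add: M1_coeff_def ke lookup_single)
  then have "tvec (sv_basis_bracket x b) * p - tscalar (pairing x b) * p =
      tscalar k * (letter e * p - tscalar (if e = M 1 then \<psi> (bvec (M 1)) else 0) * p)"
    by (simp only: ke tvec_scale tvec_bvec tscalar_simps right_diff_distrib mult.assoc)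
  also have "\<dots> deg\<le> d + weight x + weight b - 3"
    using deg_le_tscalar[OF letter_deg_le[OF p dev, of e], of k] w by (simp add: algebra_simps)
  finally have "tvec (sv_basis_bracket x b) * p - tscalar (pairing x b) * p
      deg\<le> d + weight x + weight b - 3" .
  moreover have "deviation x (letter b * p) - letter b * deviation x p - tscalar (pairing x b) * p =
      (letter x * letter b - letter b * letter x - tvec (sv_basis_bracket x b)) * p +
      (tvec (sv_basis_bracket x b) * p - tscalar (pairing x b) * p)"
    by (simp add: deviation_def algebra_simps tscalar_left_commute)
  ultimately show ?thesis
    using deg_le.add[OF deg_le.ideal[OF J_bracket[of x b p]]] by metis
qed

text \<open>Of the terms in the product rule, the scalar one is decisive: it lowers the degree by the weight
  of \<open>b\<close>, which is \<open>2 - weight x\<close> whenever \<open>[x, b]\<close> involves \<open>M 1\<close>.\<close>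

lemma deviation_deg_le: "p deg\<le> d \<Longrightarrow> x \<in> sv_plus_basis \<Longrightarrow> deviation x p deg\<le> d + weight x - 2"
proof (induction arbitrary: x rule: deg_le.induct)
  case (ideal p d)
  then show ?case by (auto simp: deviation_def intro: deg_le.ideal J_left_mult)
next
  case (scalar d c)
  then show ?case by (auto simp: deviation_simps intro: deg_le.ideal J_left_mult J_generator)
next
  case (add p d q)
  then show ?case by (auto simp: deviation_simps intro: deg_le.add)
next
  case (step b p d)
  have dev: "deviation x (letter b * p) - letter b * deviation x p - tscalar (pairing x b) * p
      deg\<le> d + weight x - 2"
    using deviation_letter[OF step.hyps(2) step.IH, of x b] by (auto elim: deg_le_mono)
  have b: "letter b * deviation x p deg\<le> d + weight x - 2"
    using deg_le_letter[OF step.hyps(1) step.IH[OF step.prems]] by (simp add: algebra_simps)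
  have m: "tscalar (pairing x b) * p deg\<le> d + weight x - 2"
  proof (cases "M1_coeff x b = 0")
    case True
    then show ?thesis by (simp add: tscalar_simps deg_le_zero)
  next
    case False
    then have "weight x + weight b = 2"
      by (cases x; cases b) (auto simp: M1_coeff_def lookup_single when_def split: if_split_asm)
    then have "d - weight b = d + weight x - 2"
      by simp
    then show ?thesis using deg_le_tscalar[OF step.hyps(2)] by metis
  qed
  show ?case by (rule deg_le_cong[OF deg_le_cong[OF dev m] b])
qed

text \<open>The operator \<open>\<Sum>b. weight b * b * (d/db)\<close> of the corresponding Weyl algebra. The sum over all
  generators is infinite; only those of weight at most \<open>N\<close> matter up to degree \<open>N\<close>.\<close>

definition euler :: "int \<Rightarrow> sv_basis talg \<Rightarrow> sv_basis talg"
  where "euler N p = (\<Sum>b\<in>{b \<in> sv_minus_basis. weight b \<le> N}.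
    tscalar (of_int (weight b) / pairing (partner b) b) * (letter b * deviation (partner b) p))"

lemma euler_add: "euler N (p + q) = euler N p + euler N q"
  by (simp add: euler_def deviation_simps distrib_left sum.distrib)

lemma letter_commute:
  assumes "a \<in> sv_minus_basis" "b \<in> sv_minus_basis" "p deg\<le> d"
  shows "letter a * (letter b * p) - letter b * (letter a * p) deg\<le> d + weight a + weight b - 3"
proof -
  obtain k e where ke: "sv_basis_bracket a b = scale k (bvec e)"
    and w: "weight e = weight a + weight b - 3"
    by (rule sv_bracket_weight)
  have "tvec (sv_basis_bracket a b) * p deg\<le> d + weight a + weight b - 3"
  proof (cases "k = 0")
    case True
    then show ?thesis by (simp add: ke tvec_scale tscalar_simps deg_le_zero)
  next
    case False
    then have "e \<in> sv_minus_basis"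
      using sv_minus_bracket[OF assms(1,2) ke] by simp
    then have "letter e * p deg\<le> d + weight a + weight b - 3"
      using deg_le_letter[OF _ assms(3), of e] w by (auto elim: deg_le_mono)
    then show ?thesis
      by (simp add: ke tvec_scale tvec_bvec mult.assoc deg_le_tscalar)
  qed
  then show ?thesis
    using deg_le.add[OF deg_le.ideal[OF J_bracket[of a b p]]] by (fastforce simp: algebra_simps)
qed

text \<open>The commutator of the Euler operator with \<open>b\<close> is \<open>weight b * b\<close> to leading order. The error
  terms are \<open>r a\<close>, from the product rule for the partner of \<open>a\<close>, and \<open>s a\<close>, from interchanging \<open>a\<close>
  and \<open>b\<close>.\<close>

lemma euler_letter:
  assumes b: "b \<in> sv_minus_basis" "weight b \<le> N" and p: "p deg\<le> d"
  shows "euler N (letter b * p) - letter b * euler N p - tscalar (of_int (weight b)) * (letter b * p)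
    deg\<le> d + weight b - 1"
proof -
  let ?B = "{b \<in> sv_minus_basis. weight b \<le> N}"
  define c where "c a = of_int (weight a) / pairing (partner a) a" for a
  define r where "r a = letter a * (deviation (partner a) (letter b * p)
      - letter b * deviation (partner a) p - tscalar (pairing (partner a) b) * p)" for a
  define s where "s a = letter a * (letter b * deviation (partner a) p)
      - letter b * (letter a * deviation (partner a) p)" for a
  have r: "r a deg\<le> d + weight b - 1" if "a \<in> sv_minus_basis" for a
    using deg_le_letter[OF that deviation_letter[OF p deviation_deg_le[OF p], of "partner a" b]]
    by (simp add: r_def weight_partner algebra_simps)
  have s: "s a deg\<le> d + weight b - 1" if "a \<in> sv_minus_basis" for a
    using letter_commute[OF that b(1) deviation_deg_le[OF p partner_plus[OF that]]]
    unfolding s_def weight_partner by (rule deg_le_mono) simp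
  have pair: "tscalar (c a) * (letter a * (tscalar (pairing (partner a) b) * p)) =
      (if a = b then tscalar (of_int (weight b)) * (letter b * p) else 0)" if "a \<in> ?B" for a
  proof (cases "a = b")
    case True
    have "c b * pairing (partner b) b = of_int (weight b)"
      using M1_coeff_partner[OF b(1)] M1_nonzero by (simp add: c_def)
    moreover have "tscalar (c b) * (letter b * (tscalar (pairing (partner b) b) * p)) =
        tscalar (c b * pairing (partner b) b) * (letter b * p)"
      by (simp only: tscalar_left_commute[of "letter b"] tscalar_simps(6) mult.assoc)
    ultimately show ?thesis using True by simp
  next
    case False
    then show ?thesis
      using that M1_coeff_partner_other[OF _ b(1), of a] by (simp add: tscalar_simps)
  qed
  have "euler N (letter b * p) = (\<Sum>a\<in>?B. tscalar (c a) * (r a + s a)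
      + letter b * (tscalar (c a) * (letter a * deviation (partner a) p))
      + tscalar (c a) * (letter a * (tscalar (pairing (partner a) b) * p)))"
    unfolding euler_def c_def[symmetric] r_def s_def
    by (intro sum.cong refl) (simp add: algebra_simps tscalar_left_commute[of "letter b"])
  also have "\<dots> = (\<Sum>a\<in>?B. tscalar (c a) * (r a + s a)) + letter b * euler N p
      + (\<Sum>a\<in>?B. tscalar (c a) * (letter a * (tscalar (pairing (partner a) b) * p)))"
    by (simp add: sum.distrib euler_def c_def sum_distrib_left)
  also have "(\<Sum>a\<in>?B. tscalar (c a) * (letter a * (tscalar (pairing (partner a) b) * p))) =
      (\<Sum>a\<in>?B. if a = b then tscalar (of_int (weight b)) * (letter b * p) else 0)"
    by (intro sum.cong refl pair)
  also have "\<dots> = tscalar (of_int (weight b)) * (letter b * p)"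
    using b by (simp add: sum.delta[OF finite_sv_minus])
  finally show ?thesis
    using r s by (auto intro!: deg_le_sum deg_le_tscalar deg_le.add)
qed

text \<open>Weighting the terms by the weight of the generator makes the eigenvalue on words of total weight
  \<open>d\<close> equal to \<open>d\<close>, irrespective of the length of the word.\<close>

lemma euler_deg_le: "p deg\<le> d \<Longrightarrow> d \<le> N \<Longrightarrow> euler N p - tscalar (of_int d) * p deg\<le> d - 1"
proof (induction rule: deg_le.induct)
  case (ideal p d)
  then have "tscalar (of_int d) * p deg\<le> d - 1" "euler N p deg\<le> d - 1"
    unfolding euler_def deviation_def by (auto intro!: deg_le_sum deg_le_tscalar intro: deg_le.ideal J_left_mult)
  then show ?case by (rule deg_le_diff[rotated])
next
  case (scalar d c)
  have "euler N (tscalar c) deg\<le> d - 1"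
    unfolding euler_def deviation_simps
    by (intro deg_le_sum deg_le_tscalar) (auto intro!: deg_le.ideal J_left_mult J_generator partner_plus)
  moreover have "tscalar (of_int d) * tscalar c deg\<le> d - 1"
  proof (cases "d = 0")
    case True
    then show ?thesis by (simp add: tscalar_simps deg_le_zero)
  next
    case False
    with scalar have "tscalar (of_int d * c) deg\<le> d - 1"
      by (intro deg_le.scalar) simp
    then show ?thesis by (simp add: tscalar_simps)
  qed
  ultimately show ?case by (rule deg_le_diff)
next
  case (add p d q)
  from deg_le.add[OF add.IH(1)[OF add.prems] add.IH(2)[OF add.prems]]
  show ?case by (simp add: euler_add algebra_simps)
next
  case (step b p d)
  let ?d = "d - weight b"
  show ?case
  proof (cases "?d < 0")
    case True
    \<comment> \<open>If \<open>b\<close> alone exceeds the degree \<open>d\<close>, then \<open>p\<close> is 0 in the module.\<close>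
    then have p: "p \<in> J"
      using deg_le_nonpos[OF step.hyps(2)] by simp
    then show ?thesis
      unfolding euler_def deviation_def
      by (auto intro!: deg_le_diff deg_le_sum deg_le_tscalar intro: deg_le.ideal J_left_mult)
  next
    case False
    then have "weight b \<le> N"
      using step.prems by simp
    from euler_letter[OF step.hyps(1) this step.hyps(2)]
    have "euler N (letter b * p) - letter b * euler N p - tscalar (of_int (weight b)) * (letter b * p)
        deg\<le> d - 1" by simp
    moreover have "letter b * (euler N p - tscalar (of_int ?d) * p) deg\<le> d - 1"
      using deg_le_letter[OF step.hyps(1) step.IH] step.prems sv_minus_weight[OF step.hyps(1)] by simp
    ultimately have "(euler N (letter b * p) - letter b * euler N p
        - tscalar (of_int (weight b)) * (letter b * p))
        + letter b * (euler N p - tscalar (of_int ?d) * p) deg\<le> d - 1"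
      by (rule deg_le.add)
    also have "(euler N (letter b * p) - letter b * euler N p
        - tscalar (of_int (weight b)) * (letter b * p))
        + letter b * (euler N p - tscalar (of_int ?d) * p)
        = euler N (letter b * p) - tscalar (of_int d) * (letter b * p)"
      by (simp add: algebra_simps tscalar_simps tscalar_left_commute)
    finally show ?thesis .
  qed
qed

text \<open>By induction on words: every letter, of \<open>sv_plus\<close> or not, raises the degree by a bounded amount.
  The maximum in the proof accounts for \<open>M 1\<close>, which does not lower the degree.\<close>

lemma deg_le_exhaustive: "\<exists>d. p deg\<le> d"
proof (induction p rule: scale_bvec_induct)
  case (1 w c)
  obtain bs where w: "w = Word bs" by (cases w)
  have "\<exists>d. bvec (Word bs) deg\<le> d"
  proof (induction bs)
    case Nil
    show ?case using deg_le.scalar[of 0 1] by (auto simp: tscalar_def zero_word_def)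
  next
    case (Cons b bs)
    then obtain d where d: "bvec (Word bs) deg\<le> d" by blast
    have split: "bvec (Word (b # bs)) = letter b * bvec (Word bs)"
      by (simp add: mult_single plus_word_def)
    have "letter b * bvec (Word bs) deg\<le> max (d + weight b) d"
      by (rule deg_le_cong[OF deg_le_mono[OF letter_deg_le[OF d deviation_deg_le[OF d]]]
            deg_le_mono[OF deg_le_tscalar[OF d]]]) auto
    then show ?case unfolding split by blast
  qed
  then obtain d where "bvec (Word bs) deg\<le> d" ..
  then have "tscalar c * bvec (Word bs) deg\<le> d"
    by (rule deg_le_tscalar)
  moreover have "scale c (bvec w) = tscalar c * bvec (Word bs)"
    by (simp add: w tscalar_def mult_single flip: single_scale)
  ultimately show ?case by auto
next
  case (2 p q)
  then obtain d d' where "p deg\<le> d" "q deg\<le> d'" by blast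
  then have "p + q deg\<le> max d d'"
    by (intro deg_le.add) (auto elim: deg_le_mono)
  then show ?case ..
qed

text \<open>The Euler operator kills \<open>p\<close> modulo \<open>J\<close>, but multiplies its part of top degree \<open>d\<close> by \<open>d\<close>. So
  the top degree can be lowered until it is 0.\<close>

lemma whittaker_scalar:
  assumes "\<And>b. b \<in> sv_plus_basis \<Longrightarrow> (letter b - tscalar (\<psi> (bvec b))) * p \<in> J"
  shows "\<exists>c. p - tscalar c \<in> J"
proof -
  have "\<exists>c. p - tscalar c \<in> J" if "p deg\<le> int n" for n
    using that
  proof (induction n)
    case 0
    then show ?case using deg_le_nonpos by auto
  next
    case (Suc n)
    let ?d = "int (Suc n)"
    have "euler ?d p deg\<le> ?d - 1"
      unfolding euler_def deviation_def
      by (intro deg_le_sum deg_le_tscalar, intro deg_le.ideal J_left_mult assms partner_plus) simp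
    from deg_le_diff[OF this euler_deg_le[OF Suc.prems order_refl]]
    have "tscalar (of_int ?d) * p deg\<le> ?d - 1"
      by simp
    from deg_le_tscalar[OF this, of "1 / of_int ?d"]
    have "tscalar (1 / of_int ?d * of_int ?d) * p deg\<le> ?d - 1"
      by (simp only: tscalar_simps(6) mult.assoc)
    also have "1 / of_int ?d * of_int ?d = (1 :: complex)"
      by (simp del: of_nat_Suc)
    finally have "p deg\<le> ?d - 1"
      by (simp add: tscalar_simps)
    then show ?case by (intro Suc.IH) simp
  qed
  moreover obtain d where "p deg\<le> d" using deg_le_exhaustive by blast
  then have "p deg\<le> int (nat d)" by (rule deg_le_mono) simp
  ultimately show ?thesis by blast
qed

end

section \<open>The enveloping algebra of the Schroedinger-Virasoro algebra\<close>

interpretation sv: closed_bracket UNIV sv_bracket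
  by standard (simp add: bspan_def)

interpretation sv_plus: closed_bracket sv_plus_basis sv_bracket
  by standard (use sv_plus_bracket_closed in \<open>simp add: sv_plus_def\<close>)

abbreviation U_class :: "sv_basis talg \<Rightarrow> sv_basis talg set"
  where "U_class \<equiv> uea_class UNIV sv_bracket"

lemma carrier_tensor_UNIV: "p \<in> carrier (tensor_algebra UNIV)"
  by (simp add: tensor_algebra_simps)

lemma U_class_simps:
  "U_class p \<in> carrier U_sv"
  "U_class (p + q) = U_class p \<oplus>\<^bsub>U_sv\<^esub> U_class q"
  "U_class (p - q) = U_class p \<ominus>\<^bsub>U_sv\<^esub> U_class q"
  "U_class (p * q) = U_class p \<otimes>\<^bsub>U_sv\<^esub> U_class q"
proof -
  interpret h: ring_hom_ring "tensor_algebra UNIV" U_sv U_class by (rule sv.class_hom)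
  note c = carrier_tensor_UNIV
  show "U_class p \<in> carrier U_sv" by (rule h.hom_closed[OF c])
  show "U_class (p + q) = U_class p \<oplus>\<^bsub>U_sv\<^esub> U_class q"
    using h.hom_add[OF c c, of p q] by (simp add: tensor_algebra_simps)
  show "U_class (p * q) = U_class p \<otimes>\<^bsub>U_sv\<^esub> U_class q"
    using h.hom_mult[OF c c, of p q] by (simp add: tensor_algebra_simps)
  show "U_class (p - q) = U_class p \<ominus>\<^bsub>U_sv\<^esub> U_class q"
    using h.hom_add[OF c c, of p "- q"] h.hom_a_inv[OF c, of q]
    by (simp add: tensor_algebra_simps tensor_algebra_uminus[OF c] a_minus_def)
qed

lemma U_class_surj: "a \<in> carrier U_sv \<Longrightarrow> \<exists>p. a = U_class p"
  using sv.class_surj by blast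

lemma sv_ideal_mult:
  assumes "i \<in> uea_ideal UNIV sv_bracket"
  shows "q * i \<in> uea_ideal UNIV sv_bracket" "i * q \<in> uea_ideal UNIV sv_bracket"
  using sv.uea_ideal_mult[OF assms carrier_tensor_UNIV] by blast+

lemma letter_relation:
  "letter a * letter b - letter b * letter a - tvec (sv_basis_bracket a b) \<in> uea_ideal UNIV sv_bracket"
  using sv.relator_in_ideal[of "bvec a" "bvec b"]
  by (simp add: bspan_def tvec_bvec sv_bracket_def bilinear_ext_bvec)

text \<open>\<open>M 0\<close> commutes with all letters by the bracket relations, hence with all words.\<close>

lemma M0_central: "letter (M 0) * p - p * letter (M 0) \<in> uea_ideal UNIV sv_bracket"
proof -
  let ?I = "uea_ideal UNIV sv_bracket" and ?z = "letter (M 0) :: sv_basis talg"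
  have letter: "?z * letter b - letter b * ?z \<in> ?I" for b
    using letter_relation[of "M 0" b] by (cases b) (simp_all add: scale_simps tvec_def)
  have word: "?z * bvec (Word bs) - bvec (Word bs) * ?z \<in> ?I" for bs
  proof (induction bs)
    case Nil
    then show ?case by (simp add: sv.uea_ideal_zero mult_single plus_word_def)
  next
    case (Cons b bs)
    have split: "bvec (Word (b # bs)) = letter b * bvec (Word bs)"
      by (simp add: mult_single plus_word_def)
    have "?z * bvec (Word (b # bs)) - bvec (Word (b # bs)) * ?z =
        (?z * letter b - letter b * ?z) * bvec (Word bs) +
        letter b * (?z * bvec (Word bs) - bvec (Word bs) * ?z)"
      unfolding split by (simp only: algebra_simps)
    also have "\<dots> \<in> ?I"
      by (intro sv.uea_ideal_add sv_ideal_mult letter Cons.IH)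
    finally show ?case .
  qed
  show ?thesis
  proof (induction p rule: scale_bvec_induct)
    case (1 w c)
    have w: "scale c (bvec w) = tscalar c * bvec (Word (letters w))"
      by (simp add: tscalar_def mult_single flip: single_scale)
    have "?z * scale c (bvec w) - scale c (bvec w) * ?z =
        tscalar c * (?z * bvec (Word (letters w)) - bvec (Word (letters w)) * ?z)"
      unfolding w by (simp only: right_diff_distrib tscalar_left_commute[of ?z] mult.assoc)
    then show ?case
      using sv_ideal_mult(1)[OF word[of "letters w"], of "tscalar c"] by simp
  next
    case (2 p q)
    from sv.uea_ideal_add[OF this] show ?case by (simp add: algebra_simps)
  qed
qed

lemma U_class_commute:
  assumes "p * q - q * p \<in> uea_ideal UNIV sv_bracket"
  shows "U_class p \<otimes>\<^bsub>U_sv\<^esub> U_class q = U_class q \<otimes>\<^bsub>U_sv\<^esub> U_class p"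
  using sv.class_cong[OF assms carrier_tensor_UNIV, of "q * p"] by (simp add: U_class_simps(4))

section \<open>Whittaker vectors\<close>

text \<open>The action of a coset is well defined since the character vanishes on the ideal.\<close>

lemma act_C_psi_class:
  assumes "sv_plus_character \<psi>" "p \<in> carrier (tensor_algebra sv_plus_basis)"
  shows "act (C_psi \<psi>) (uea_class sv_plus_basis sv_bracket p) \<alpha> = eval_character \<psi> p * \<alpha>"
proof -
  have foldr: "foldr (\<lambda>b \<beta>. \<psi> (bvec b) * \<beta>) bs \<alpha> = (\<Prod>b\<leftarrow>bs. \<psi> (bvec b)) * \<alpha>" for bs
    by (induction bs) simp_all
  have "act (C_psi \<psi>) u \<alpha> = the_elem ((\<lambda>p. eval_character \<psi> p * \<alpha>) ` u)" for u
    by (simp add: C_psi_def foldr eval_character_def sum_distrib_right mult.assoc)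
  also have "the_elem ((\<lambda>p. eval_character \<psi> p * \<alpha>) ` uea_class sv_plus_basis sv_bracket p)
      = eval_character \<psi> p * \<alpha>"
    using assms(2) eval_character_uea_ideal[OF sv_plus.closed_bracket_axioms assms(1)]
    by (intro sv_plus.the_elem_class) (simp_all add: eval_character_add)
  finally show ?thesis .
qed

locale whittaker_module =
  fixes \<psi> :: "sv \<Rightarrow> complex" and \<xi> :: complex
  assumes character: "sv_plus_character \<psi>"
begin

abbreviation "W \<equiv> W_psi \<psi>"
abbreviation "Q \<equiv> L_psi_xi \<psi> \<xi>"
abbreviation "z \<equiv> U_class (letter (M 0) - tscalar \<xi>)"

lemma C_psi_simps: "carrier (C_psi \<psi>) = UNIV"
  by (simp add: C_psi_def)

sublocale ext: scalar_extension U_sv_plus "uea_incl UNIV sv_bracket" U_sv "C_psi \<psi>"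
proof (intro scalar_extension.intro scalar_extension_axioms.intro)
  show "ring U_sv"
    by (rule sv.ring_uea)
  fix s assume "s \<in> carrier U_sv_plus"
  then obtain p where "p \<in> carrier (tensor_algebra sv_plus_basis)"
    "s = uea_class sv_plus_basis sv_bracket p"
    using sv_plus.class_surj by blast
  then show "uea_incl UNIV sv_bracket s \<in> carrier U_sv"
    by (simp add: uea_incl_class sv.closed_bracket_axioms sv_plus.closed_bracket_axioms U_class_simps)
qed (simp_all add: C_psi_simps)

sublocale W: left_module U_sv W
  unfolding W_psi_def by (rule ext.left_module_tensor)

lemma w_psi_closed: "w_psi \<psi> \<in> carrier W"
  unfolding w_psi_def W_psi_def by (rule ext.pure_closed) (simp_all add: C_psi_simps)

text \<open>An element of the smaller enveloping algebra can be moved across the tensor sign, where it acts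
  through the character.\<close>

lemma act_W_plus:
  assumes "p \<in> carrier (tensor_algebra sv_plus_basis)"
  shows "act W (U_class p) (w_psi \<psi>) = ext.pure \<one>\<^bsub>U_sv\<^esub> (eval_character \<psi> p)"
proof -
  have s: "uea_class sv_plus_basis sv_bracket p \<in> carrier U_sv_plus"
    by (rule sv_plus.class_closed[OF assms])
  have "act W (U_class p) (w_psi \<psi>) = ext.pure (U_class p) 1"
    unfolding W_psi_def w_psi_def
    using ext.act_pure[of "U_class p" "\<one>\<^bsub>U_sv\<^esub>" 1] ext.R.r_one[OF U_class_simps(1)[of p]]
    by (simp add: U_class_simps(1) C_psi_simps)
  also have "\<dots> = ext.pure (\<one>\<^bsub>U_sv\<^esub> \<otimes>\<^bsub>U_sv\<^esub> U_class p) 1"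
    using ext.R.l_one[OF U_class_simps(1)[of p]] by simp
  also have "\<dots> = ext.pure \<one>\<^bsub>U_sv\<^esub> (act (C_psi \<psi>) (uea_class sv_plus_basis sv_bracket p) 1)"
    using ext.pure_balanced[OF ext.R.one_closed s, of 1] assms
    by (simp add: C_psi_simps uea_incl_class sv.closed_bracket_axioms sv_plus.closed_bracket_axioms)
  also have "act (C_psi \<psi>) (uea_class sv_plus_basis sv_bracket p) 1 = eval_character \<psi> p"
    using act_C_psi_class[OF character assms] by simp
  finally show ?thesis .
qed

lemma W_cyclic:
  assumes "x \<in> carrier W"
  obtains p where "x = act W (U_class p) (w_psi \<psi>)"
proof -
  have "\<exists>r\<in>carrier U_sv. x = act W r (w_psi \<psi>)"
    unfolding W_psi_def w_psi_def
  proof (rule ext.tensor_cyclic)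
    fix u :: complex
    let ?s = "uea_class sv_plus_basis sv_bracket (tscalar u)"
    have "?s \<in> carrier U_sv_plus"
      by (rule sv_plus.class_closed[OF tscalar_closed])
    moreover have "act (C_psi \<psi>) ?s 1 = u"
      using act_C_psi_class[OF character tscalar_closed]
      by (simp add: eval_character_tscalar)
    ultimately show "\<exists>s\<in>carrier U_sv_plus. act (C_psi \<psi>) s 1 = u" by blast
  qed (use assms in \<open>simp_all add: C_psi_simps W_psi_def\<close>)
  then show ?thesis using that U_class_surj by blast
qed

lemma z_central: "r \<in> carrier U_sv \<Longrightarrow> r \<otimes>\<^bsub>U_sv\<^esub> z = z \<otimes>\<^bsub>U_sv\<^esub> r"
proof -
  assume "r \<in> carrier U_sv"
  then obtain p where "r = U_class p" using U_class_surj by blast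
  moreover have "(letter (M 0) - tscalar \<xi>) * p - p * (letter (M 0) - tscalar \<xi>)
      = letter (M 0) * p - p * letter (M 0)"
    by (simp add: algebra_simps tscalar_commute)
  ultimately show ?thesis
    using U_class_commute[of "letter (M 0) - tscalar \<xi>" p] M0_central[of p] by simp
qed

text \<open>The image of \<open>z\<close> is stable under the enveloping algebra because \<open>z\<close> is central, so the quotient by
  it is a module.\<close>

lemma central_submodule_eq: "central_submodule \<psi> \<xi> = act W z ` carrier W"
  by (simp add: central_submodule_def U_vec_def U_scalar_def tvec_bvec U_class_simps(3))

sublocale N: stable_subgroup U_sv W "central_submodule \<psi> \<xi>"
proof (intro stable_subgroup.intro W.ring_action_axioms stable_subgroup_axioms.intro)
  have z: "z \<in> carrier U_sv" by (rule U_class_simps)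
  show "subgroup (central_submodule \<psi> \<xi>) W"
    unfolding central_submodule_eq
  proof (rule W.subgroupI)
    show "inv\<^bsub>W\<^esub> a \<in> act W z ` carrier W" if "a \<in> act W z ` carrier W" for a
      using that by (auto simp: z simp flip: W.act_inv)
    show "a \<otimes>\<^bsub>W\<^esub> b \<in> act W z ` carrier W"
      if "a \<in> act W z ` carrier W" "b \<in> act W z ` carrier W" for a b
      using that by (auto simp: z simp flip: W.act_mult)
  qed (use z in auto)
  fix r n assume r: "r \<in> carrier U_sv" and "n \<in> central_submodule \<psi> \<xi>"
  then obtain x where x: "x \<in> carrier W" "n = act W z x"
    by (auto simp: central_submodule_eq)
  then have "act W r n = act W z (act W r x)"
    using r z z_central[OF r] by (simp flip: W.act_assoc)
  then show "act W r n \<in> central_submodule \<psi> \<xi>"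
    using r x by (auto simp: central_submodule_eq)
qed

sublocale Q: left_module U_sv Q
  unfolding L_psi_xi_def by (rule N.left_module_quot) (simp add: W.act_add)

lemma Q_coset_closed: "x \<in> carrier W \<Longrightarrow> central_submodule \<psi> \<xi> #>\<^bsub>W\<^esub> x \<in> carrier Q"
  by (simp add: L_psi_xi_def N.carrier_quot)

lemma act_Q: "r \<in> carrier U_sv \<Longrightarrow> x \<in> carrier W \<Longrightarrow>
    act Q r (central_submodule \<psi> \<xi> #>\<^bsub>W\<^esub> x) = central_submodule \<psi> \<xi> #>\<^bsub>W\<^esub> act W r x"
  by (simp add: L_psi_xi_def N.act_quot)

lemma w_bar_closed: "w_bar \<psi> \<xi> \<in> carrier Q"
  unfolding w_bar_def by (rule Q_coset_closed[OF w_psi_closed])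

lemma Q_cyclic:
  assumes "v \<in> carrier Q"
  obtains p where "v = act Q (U_class p) (w_bar \<psi> \<xi>)"
proof -
  obtain x where x: "x \<in> carrier W" "v = central_submodule \<psi> \<xi> #>\<^bsub>W\<^esub> x"
    using assms by (auto simp: L_psi_xi_def N.carrier_quot)
  obtain p where "x = act W (U_class p) (w_psi \<psi>)"
    using W_cyclic[OF x(1)] .
  then have "v = act Q (U_class p) (w_bar \<psi> \<xi>)"
    unfolding w_bar_def using x by (simp add: act_Q U_class_simps(1) w_psi_closed)
  then show ?thesis by (rule that)
qed

lemma z_annihilates:
  assumes "v \<in> carrier Q"
  shows "act Q z v = \<one>\<^bsub>Q\<^esub>"
proof -
  obtain x where x: "x \<in> carrier W" "v = central_submodule \<psi> \<xi> #>\<^bsub>W\<^esub> x"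
    using assms by (auto simp: L_psi_xi_def N.carrier_quot)
  have "act W z x \<in> central_submodule \<psi> \<xi>"
    using x(1) by (simp add: central_submodule_eq)
  then show ?thesis
    using x N.coset_eq_self_iff[of "act W z x"]
    by (simp add: act_Q U_class_simps(1)) (simp add: L_psi_xi_def N.one_quot)
qed

lemma act_plus_w_bar:
  assumes "p \<in> carrier (tensor_algebra sv_plus_basis)"
  shows "act Q (U_class p) (w_bar \<psi> \<xi>) = act Q (U_class (tscalar (eval_character \<psi> p))) (w_bar \<psi> \<xi>)"
  unfolding w_bar_def
  by (simp add: act_Q U_class_simps(1) w_psi_closed act_W_plus[OF assms] act_W_plus[OF tscalar_closed]
      eval_character_tscalar)

definition annihilator :: "sv_basis talg set"
  where "annihilator = {p. act Q (U_class p) (w_bar \<psi> \<xi>) = \<one>\<^bsub>Q\<^esub>}"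

lemma annihilator_diff_iff:
  "p - q \<in> annihilator \<longleftrightarrow> act Q (U_class p) (w_bar \<psi> \<xi>) = act Q (U_class q) (w_bar \<psi> \<xi>)"
proof -
  let ?x = "act Q (U_class p) (w_bar \<psi> \<xi>)" and ?y = "act Q (U_class q) (w_bar \<psi> \<xi>)"
  have c: "?x \<in> carrier Q" "?y \<in> carrier Q"
    by (simp_all add: U_class_simps(1) w_bar_closed)
  have "p - q \<in> annihilator \<longleftrightarrow> ?x \<otimes>\<^bsub>Q\<^esub> inv\<^bsub>Q\<^esub> ?y = \<one>\<^bsub>Q\<^esub>"
    by (simp add: annihilator_def U_class_simps(1,3) Q.act_minus w_bar_closed)
  also have "\<dots> \<longleftrightarrow> ?x = ?y"
    using c by (metis Q.inv_closed Q.inv_equality Q.inv_inv Q.r_inv)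
  finally show ?thesis .
qed

text \<open>The relations that may be multiplied by \<open>p\<close> from the right vanish in the enveloping algebra, or, for
  \<open>M 0\<close>, kill the whole quotient; those for \<open>sv_plus\<close> come from balancedness of the tensor product.\<close>

lemma whittaker_ideal_annihilator:
  assumes "\<psi> (bvec (M 1)) \<noteq> 0"
  shows "whittaker_ideal \<psi> \<xi> annihilator"
proof
  have act_mult: "act Q (U_class (q * p)) (w_bar \<psi> \<xi>) = act Q (U_class q) (act Q (U_class p) (w_bar \<psi> \<xi>))"
    for p q by (simp add: U_class_simps(1,4) Q.act_assoc w_bar_closed)
  have ideal: "i \<in> annihilator" if "i \<in> uea_ideal UNIV sv_bracket" for i
    using sv.class_zero[OF that] by (simp add: annihilator_def Q.act_zero w_bar_closed)
  show "0 \<in> annihilator"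
    by (rule ideal[OF sv.uea_ideal_zero])
  show "p + q \<in> annihilator" if "p \<in> annihilator" "q \<in> annihilator" for p q
    using that by (simp add: annihilator_def U_class_simps(1,2) Q.act_add w_bar_closed)
  show "q * p \<in> annihilator" if "p \<in> annihilator" for p q
    using that by (simp add: annihilator_def act_mult U_class_simps(1))
  show "(letter a * letter b - letter b * letter a - tvec (sv_basis_bracket a b)) * p \<in> annihilator" for a b p
    by (intro ideal sv_ideal_mult letter_relation)
  show "(letter (M 0) - tscalar \<xi>) * p \<in> annihilator" for p
    unfolding annihilator_def by (simp add: act_mult z_annihilates U_class_simps(1) w_bar_closed)
  fix b assume b: "b \<in> sv_plus_basis"
  then have "letter b \<in> carrier (tensor_algebra sv_plus_basis)"
    by (simp add: tensor_algebra_simps)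
  from act_plus_w_bar[OF this] show "letter b - tscalar (\<psi> (bvec b)) \<in> annihilator"
    by (simp add: annihilator_diff_iff eval_character_single)
qed (fact character assms)+

lemma whittaker_iff_scalar:
  assumes "\<psi> (bvec (M 1)) \<noteq> 0" and v: "v \<in> carrier Q"
  shows "whittaker_vector \<psi> Q v \<longleftrightarrow> (\<exists>c. v = act Q (U_scalar c) (w_bar \<psi> \<xi>))"
proof
  have act_mult: "act Q (U_class q) (act Q (U_class p) (w_bar \<psi> \<xi>)) = act Q (U_class (q * p)) (w_bar \<psi> \<xi>)"
    for p q by (simp add: U_class_simps(1,4) Q.act_assoc w_bar_closed)
  {
    assume wh: "whittaker_vector \<psi> Q v"
    obtain p where p: "v = act Q (U_class p) (w_bar \<psi> \<xi>)"
      using Q_cyclic[OF v] .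
    have "(letter b - tscalar (\<psi> (bvec b))) * p \<in> annihilator" if "b \<in> sv_plus_basis" for b
    proof -
      have "bvec b \<in> sv_plus"
        using that by (simp add: sv_plus_def bspan_def)
      with wh have "act Q (U_vec (bvec b)) v = act Q (U_scalar (\<psi> (bvec b))) v"
        by (simp add: whittaker_vector_def)
      then show ?thesis
        by (simp add: left_diff_distrib annihilator_diff_iff p act_mult U_vec_def U_scalar_def tvec_bvec)
    qed
    then obtain c where "p - tscalar c \<in> annihilator"
      using whittaker_ideal.whittaker_scalar[OF whittaker_ideal_annihilator[OF assms(1)]] by blast
    then show "\<exists>c. v = act Q (U_scalar c) (w_bar \<psi> \<xi>)"
      by (auto simp: annihilator_diff_iff p U_scalar_def)
  }
  assume "\<exists>c. v = act Q (U_scalar c) (w_bar \<psi> \<xi>)"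
  then obtain c where c: "v = act Q (U_class (tscalar c)) (w_bar \<psi> \<xi>)"
    by (auto simp: U_scalar_def)
  have "act Q (U_class (tvec x)) v = act Q (U_class (tscalar (\<psi> x))) v" if "x \<in> sv_plus" for x
  proof -
    have x: "x \<in> bspan sv_plus_basis" using that by (simp add: sv_plus_def)
    have "act Q (U_class (tvec x)) v = act Q (U_class (tscalar c)) (act Q (U_class (tvec x)) (w_bar \<psi> \<xi>))"
      by (simp add: c act_mult tscalar_commute[of c])
    also have "act Q (U_class (tvec x)) (w_bar \<psi> \<xi>) = act Q (U_class (tscalar (\<psi> x))) (w_bar \<psi> \<xi>)"
      using act_plus_w_bar[OF tvec_closed[OF x]] eval_character_tvec[OF character x] by simp
    also have "act Q (U_class (tscalar c)) \<dots> = act Q (U_class (tscalar (\<psi> x))) v"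
      by (simp add: c act_mult tscalar_commute[of c])
    finally show ?thesis .
  qed
  then show "whittaker_vector \<psi> Q v"
    using v by (simp add: whittaker_vector_def U_vec_def U_scalar_def)
qed

end

theorem theorem3p7:
  fixes \<psi> :: "sv \<Rightarrow> complex" and \<xi> :: complex
    and v :: "(sv_basis talg set \<times> complex \<Rightarrow>\<^sub>0 int) set set"
  assumes "sv_plus_character \<psi>"
    and "\<psi> (bvec (M 1)) \<noteq> 0"
    and "v \<in> carrier (L_psi_xi \<psi> \<xi>)"
  shows "whittaker_vector \<psi> (L_psi_xi \<psi> \<xi>) v \<longleftrightarrow>
    (\<exists>c::complex. v = act (L_psi_xi \<psi> \<xi>) (U_scalar c) (w_bar \<psi> \<xi>))"
  using whittaker_module.whittaker_iff_scalar[OF whittaker_module.intro] assms by blast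

end
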